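(* Let $R$ be a Noetherian ring, let $I,J$ be ideals of $R$, let $T$ be a finitely generated $R$-module and let $U,V,W$ be submodules of $T$ with $W\subseteq V$. For $n\ge 0$ put $T_n=(U+I^nV)/I^nW$. Then the sequence $\{\operatorname{depth}_J T_n\}_{n\ge 0}$ is eventually constant.
   Context: For a finitely generated module $N$, $\operatorname{depth}_J N$ is the length of a maximal $N$-regular sequence in $J$, with the convention $\operatorname{depth}_J N=\infty$ if $JN=N$. *)

theory Defs
  imports Main "HOL-Library.Extended_Nat"
begin

definition ideal :: "'a::comm_ring_1 set \<Rightarrow> bool" where
  "ideal I \<longleftrightarrow> module.subspace ((*) :: 'a \<Rightarrow> 'a \<Rightarrow> 'a) I"

definition noetherian_ring :: "'a::comm_ring_1 itself \<Rightarrow> bool" where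
  "noetherian_ring _ \<longleftrightarrow>
     (\<forall>I::'a set. ideal I \<longrightarrow> (\<exists>F. finite F \<and> I = module.span ((*) :: 'a \<Rightarrow> 'a \<Rightarrow> 'a) F))"

fun ideal_pow :: "'a::comm_ring_1 set \<Rightarrow> nat \<Rightarrow> 'a set" where
  "ideal_pow I 0 = UNIV"
| "ideal_pow I (Suc n) =
     module.span ((*) :: 'a \<Rightarrow> 'a \<Rightarrow> 'a) {a * b | a b. a \<in> ideal_pow I n \<and> b \<in> I}"

definition smod :: "('a::comm_ring_1 \<Rightarrow> 'b::ab_group_add \<Rightarrow> 'b) \<Rightarrow> 'a set \<Rightarrow> 'b set \<Rightarrow> 'b set" where
  "smod scale I N = module.span scale {scale a x | a x. a \<in> I \<and> x \<in> N}"

definition msum :: "('a::comm_ring_1 \<Rightarrow> 'b::ab_group_add \<Rightarrow> 'b) \<Rightarrow> 'b set \<Rightarrow> 'b set \<Rightarrow> 'b set" where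
  "msum scale A B = module.span scale (A \<union> B)"

definition fin_gen :: "('a::comm_ring_1 \<Rightarrow> 'b::ab_group_add \<Rightarrow> 'b) \<Rightarrow> 'b set \<Rightarrow> bool" where
  "fin_gen scale T \<longleftrightarrow> (\<exists>F. finite F \<and> T = module.span scale F)"

text \<open>Quotient modules N/L (L a submodule of N) are represented by the pair (N, L).
  The sequence xs = [x_1,...,x_r] is (N/L)-regular in J iff every x_i lies in J,
  x_(i+1) is a nonzerodivisor on N/(L + (x_1,...,x_i)N), and N /= L + (x_1,...,x_r)N.\<close>
definition regular_seq ::
  "('a::comm_ring_1 \<Rightarrow> 'b::ab_group_add \<Rightarrow> 'b) \<Rightarrow> 'a set \<Rightarrow> 'b set \<Rightarrow> 'b set \<Rightarrow> 'a list \<Rightarrow> bool" where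
  "regular_seq scale J N L xs \<longleftrightarrow>
     set xs \<subseteq> J \<and>
     (\<forall>i < length xs. \<forall>y \<in> N.
        scale (xs ! i) y \<in> msum scale L (smod scale (set (take i xs)) N) \<longrightarrow>
        y \<in> msum scale L (smod scale (set (take i xs)) N)) \<and>
     \<not> N \<subseteq> msum scale L (smod scale (set xs) N)"

definition maximal_regular_seq ::
  "('a::comm_ring_1 \<Rightarrow> 'b::ab_group_add \<Rightarrow> 'b) \<Rightarrow> 'a set \<Rightarrow> 'b set \<Rightarrow> 'b set \<Rightarrow> 'a list \<Rightarrow> bool" where
  "maximal_regular_seq scale J N L xs \<longleftrightarrow>
     regular_seq scale J N L xs \<and> \<not> (\<exists>y \<in> J. regular_seq scale J N L (xs @ [y]))"

text \<open>depth_J (N/L): infinity if J(N/L) = N/L, otherwise the length of a maximal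
  (N/L)-regular sequence in J (all such have the same length for finitely generated
  modules over Noetherian rings; we take the supremum of these lengths).\<close>
definition depth ::
  "('a::comm_ring_1 \<Rightarrow> 'b::ab_group_add \<Rightarrow> 'b) \<Rightarrow> 'a set \<Rightarrow> 'b set \<Rightarrow> 'b set \<Rightarrow> enat" where
  "depth scale J N L =
     (if N \<subseteq> msum scale L (smod scale J N) then \<infinity>
      else Sup {enat (length xs) | xs. maximal_regular_seq scale J N L xs})"

end

theory Submission
  imports Defs "HOL-Library.Function_Algebras"
begin

text \<open>The depth of \<open>N/L\<close> in \<open>J\<close> is the first degree in which the Koszul cohomology of \<open>N/L\<close> with
  respect to generators \<open>x\<^sub>1, \<dots>, x\<^sub>r\<close> of \<open>J\<close> is nonzero, and it is at most \<open>r\<close> unless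
  \<open>N = L + JN\<close>. For \<open>N = U + I\<^sup>n V\<close> and \<open>L = I\<^sup>n W\<close> let \<open>Z\<^sub>n\<close> be the cocycles in a fixed degree
  and \<open>B\<^sub>n\<close> the sum of the coboundaries and the cochains with values in \<open>L\<close>. Then \<open>B\<^sub>n\<close> decreases
  and \<open>I B\<^sub>n \<subseteq> B\<^bsub>n+1\<^esub>\<close>, whereas the Artin-Rees lemma gives \<open>Z\<^bsub>n+1\<^esub> = K + I Z\<^sub>n\<close> for large \<open>n\<close>, where
  \<open>K\<close> consists of the cochains with values in \<open>U\<close> whose differential vanishes. As \<open>n\<close> grows, the
  inclusion \<open>K \<subseteq> B\<^sub>n\<close> can only turn from true to false and, if it always holds,
  \<open>Z\<^sub>n \<subseteq> B\<^sub>n\<close> only from false to true. Hence the vanishing of the cohomology in each of the finitely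
  many relevant degrees is eventually constant.\<close>

section \<open>Products of ideals and submodules\<close>

interpretation ring: module "(*) :: 'a::comm_ring_1 \<Rightarrow> 'a \<Rightarrow> 'a"
  by standard (auto simp: algebra_simps)

context module
begin

abbreviation ideal_smul :: "'a set \<Rightarrow> 'b set \<Rightarrow> 'b set" (infixr "\<odot>" 75) where
  "A \<odot> X \<equiv> smod scale A X"

abbreviation submodule_sum :: "'b set \<Rightarrow> 'b set \<Rightarrow> 'b set" (infixl "\<oplus>" 65) where
  "X \<oplus> Y \<equiv> msum scale X Y"

lemma subspace_msum: "subspace (X \<oplus> Y)"
  by (simp add: msum_def)

lemma msumE:
  assumes "z \<in> X \<oplus> Y" and "subspace X" and "subspace Y"
  obtains x y where "x \<in> X" "y \<in> Y" "z = x + y"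
  using assms unfolding msum_def span_Un by (auto simp: span_eq_iff[THEN iffD2])

lemma msum_commute: "X \<oplus> Y = Y \<oplus> X"
  by (simp add: msum_def Un_commute)

lemma msum_upper1: "X \<subseteq> X \<oplus> Y"
  unfolding msum_def by (meson Un_upper1 order_trans span_superset)

lemma msum_upper2: "Y \<subseteq> X \<oplus> Y"
  unfolding msum_def by (meson Un_upper2 order_trans span_superset)

lemma msum_least: "subspace Z \<Longrightarrow> X \<subseteq> Z \<Longrightarrow> Y \<subseteq> Z \<Longrightarrow> X \<oplus> Y \<subseteq> Z"
  unfolding msum_def by (intro span_minimal) auto

lemma msum_mono: "X \<subseteq> X' \<Longrightarrow> Y \<subseteq> Y' \<Longrightarrow> X \<oplus> Y \<subseteq> X' \<oplus> Y'"
  unfolding msum_def by (intro span_mono) auto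

lemma msumI: "x \<in> X \<Longrightarrow> y \<in> Y \<Longrightarrow> x + y \<in> X \<oplus> Y"
  by (meson msum_upper1 msum_upper2 subsetD subspace_add subspace_msum)

lemma msum_assoc: "(X \<oplus> Y) \<oplus> Z = X \<oplus> (Y \<oplus> Z)"
  by (intro equalityI msum_least subspace_msum) (meson msum_upper1 msum_upper2 order_trans)+

lemma msum_absorb1: "subspace X \<Longrightarrow> Y \<subseteq> X \<Longrightarrow> X \<oplus> Y = X"
  using msum_least msum_upper1 by (intro equalityI) auto

lemma msum_modular:
  assumes "subspace X" "subspace Y" "subspace Z" "Y \<subseteq> Z"
  shows "(X \<oplus> Y) \<inter> Z \<subseteq> (X \<inter> Z) \<oplus> Y"
proof
  fix z assume "z \<in> (X \<oplus> Y) \<inter> Z"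
  then obtain x y where x_mem: "x \<in> X" and y_mem: "y \<in> Y" and z_eq: "z = x + y" and "z \<in> Z"
    using assms by (auto elim: msumE)
  then have "x \<in> Z"
    using assms(3,4) subspace_diff[of Z z y] by auto
  then show "z \<in> (X \<inter> Z) \<oplus> Y"
    unfolding z_eq using x_mem y_mem by (intro msumI) auto
qed

lemma subspace_smod: "subspace (A \<odot> X)"
  by (simp add: smod_def)

lemma smodI: "a \<in> A \<Longrightarrow> x \<in> X \<Longrightarrow> a *s x \<in> A \<odot> X"
  unfolding smod_def by (rule span_base) auto

lemma smod_least: "subspace Y \<Longrightarrow> (\<And>a x. a \<in> A \<Longrightarrow> x \<in> X \<Longrightarrow> a *s x \<in> Y) \<Longrightarrow> A \<odot> X \<subseteq> Y"
  unfolding smod_def by (intro span_minimal) auto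

lemma smod_mono: "A \<subseteq> B \<Longrightarrow> X \<subseteq> Y \<Longrightarrow> A \<odot> X \<subseteq> B \<odot> Y"
  by (intro smod_least subspace_smod smodI) auto

lemma smod_subset: "subspace X \<Longrightarrow> A \<odot> X \<subseteq> X"
  by (intro smod_least) (auto intro: subspace_scale)

lemma smod_empty: "{} \<odot> X = {0}"
  by (simp add: smod_def)

lemma smod_Un: "(A \<union> B) \<odot> X = A \<odot> X \<oplus> B \<odot> X"
proof (rule equalityI)
  show "(A \<union> B) \<odot> X \<subseteq> A \<odot> X \<oplus> B \<odot> X"
    by (intro smod_least subspace_msum) (meson UnE msum_upper1 msum_upper2 smodI subsetD)
  show "A \<odot> X \<oplus> B \<odot> X \<subseteq> (A \<union> B) \<odot> X"
    by (intro msum_least subspace_smod smod_mono order_refl Un_upper1 Un_upper2)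
qed

lemma smod_msum:
  assumes "subspace X" "subspace Y"
  shows "A \<odot> (X \<oplus> Y) = A \<odot> X \<oplus> A \<odot> Y"
proof (intro equalityI smod_least subspace_msum)
  fix a z assume "a \<in> A" "z \<in> X \<oplus> Y"
  then show "a *s z \<in> A \<odot> X \<oplus> A \<odot> Y"
    using assms by (auto simp: scale_right_distrib elim!: msumE intro!: msumI smodI)
qed (intro msum_least subspace_smod smod_mono order_refl msum_upper1 msum_upper2)

lemma smod_smod_subset: "A \<odot> (B \<odot> X) \<subseteq> B \<odot> (A \<odot> X)"
proof (intro smod_least subspace_smod)
  fix a y assume a_mem: "a \<in> A" and y_mem: "y \<in> B \<odot> X"
  have "B \<odot> X \<subseteq> (*s) a -` (B \<odot> (A \<odot> X))"
  proof (intro smod_least module_hom.subspace_vimage[OF module_hom_scale_self] subspace_smod)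
    fix b x assume "b \<in> B" "x \<in> X"
    then have "b *s (a *s x) \<in> B \<odot> (A \<odot> X)" using a_mem by (intro smodI)
    then show "b *s x \<in> (*s) a -` (B \<odot> (A \<odot> X))" by (simp add: mult.commute)
  qed
  with y_mem show "a *s y \<in> B \<odot> (A \<odot> X)" by blast
qed

lemma smod_singleton:
  assumes "subspace X"
  shows "{a} \<odot> X = (*s) a ` X"
proof (intro equalityI smod_least)
  show "subspace ((*s) a ` X)"
    using assms by (rule module_hom.subspace_image[OF module_hom_scale_self])
qed (auto intro: smodI)

lemma smod_span:
  assumes "subspace X"
  shows "ring.span F \<odot> X = F \<odot> X"
proof (rule equalityI)
  have "c *s x \<in> F \<odot> X" if "c \<in> ring.span F" "x \<in> X" for c x
  proof -
    have "ring.span F \<subseteq> (\<lambda>c. c *s x) -` (F \<odot> X)"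
      using that(2) by (intro ring.span_minimal subspace_smod
          module_hom.subspace_vimage[OF module_hom_scale_left]) (auto intro: smodI)
    with that(1) show ?thesis by blast
  qed
  then show "ring.span F \<odot> X \<subseteq> F \<odot> X"
    by (intro smod_least subspace_smod)
  show "F \<odot> X \<subseteq> ring.span F \<odot> X"
    by (intro smod_mono ring.span_superset order_refl)
qed

lemma smod_ideal_pow_Suc:
  assumes "subspace X"
  shows "ideal_pow A (Suc n) \<odot> X = A \<odot> (ideal_pow A n \<odot> X)"
proof -
  let ?P = "{a * b |a b. a \<in> ideal_pow A n \<and> b \<in> A}"
  have "?P \<odot> X = A \<odot> (ideal_pow A n \<odot> X)"
  proof (intro equalityI smod_least subspace_smod)
    fix c x assume "c \<in> ?P" "x \<in> X"
    then obtain a b where "c = b * a" "a \<in> ideal_pow A n" "b \<in> A" "x \<in> X"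
      by (auto simp: mult.commute)
    then show "c *s x \<in> A \<odot> (ideal_pow A n \<odot> X)"
      by (metis scale_scale smodI)
  next
    fix b y assume b_mem: "b \<in> A" and y_mem: "y \<in> ideal_pow A n \<odot> X"
    have "ideal_pow A n \<odot> X \<subseteq> (*s) b -` (?P \<odot> X)"
    proof (intro smod_least module_hom.subspace_vimage[OF module_hom_scale_self] subspace_smod)
      fix a x assume "a \<in> ideal_pow A n" "x \<in> X"
      with b_mem have "(a * b) *s x \<in> ?P \<odot> X" by (intro smodI) auto
      then show "a *s x \<in> (*s) b -` (?P \<odot> X)" by (simp add: mult.commute)
    qed
    with y_mem show "b *s y \<in> ?P \<odot> X" by blast
  qed
  then show ?thesis by (simp add: smod_span[OF assms])
qed

end

context module_hom
begin

lemma image_smod: "f ` smod s1 A X = smod s2 A (f ` X)"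
proof -
  have "f ` {a *a x |a x. a \<in> A \<and> x \<in> X} = {a *b y |a y. a \<in> A \<and> y \<in> f ` X}"
    by (force simp: scale[symmetric])
  then show ?thesis
    unfolding smod_def span_image[symmetric] by simp
qed

end

section \<open>Noetherian modules\<close>

definition (in module) noetherian :: "'b set \<Rightarrow> bool" where
  "noetherian X \<longleftrightarrow> (\<forall>Y. subspace Y \<longrightarrow> Y \<subseteq> X \<longrightarrow> fin_gen scale Y)"

definition (in module) colon :: "'b set \<Rightarrow> 'b \<Rightarrow> 'a set" where
  "colon L x = {c. c *s x \<in> L}"

context module
begin

lemma noetherian_subset: "noetherian X \<Longrightarrow> Y \<subseteq> X \<Longrightarrow> noetherian Y"
  unfolding noetherian_def by blast

lemma noetherian_span_eq_span_finite:
  assumes "noetherian X" "subspace X" "Z \<subseteq> X"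
  obtains F where "finite F" "F \<subseteq> Z" "span Z = span F"
proof -
  obtain G where finite_G: "finite G" and span_Z: "span Z = span G"
    using assms(1) span_minimal[OF assms(3,2)] unfolding noetherian_def fin_gen_def by blast
  have "\<exists>F. finite F \<and> F \<subseteq> Z \<and> g \<in> span F" if "g \<in> G" for g
  proof -
    from that have "g \<in> span Z" unfolding span_Z by (rule span_base)
    then obtain F r where "finite F" "F \<subseteq> Z" "g = (\<Sum>a\<in>F. r a *s a)"
      unfolding span_explicit by blast
    then show ?thesis
      by (intro exI[of _ F]) (auto intro: span_sum span_scale span_base)
  qed
  then obtain F where F_spec: "\<And>g. g \<in> G \<Longrightarrow> finite (F g) \<and> F g \<subseteq> Z \<and> g \<in> span (F g)"
    by metis
  let ?F = "\<Union>g\<in>G. F g"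
  have "g \<in> span ?F" if "g \<in> G" for g
    using F_spec[OF that] span_mono[of "F g" ?F] that by blast
  then have "span Z \<subseteq> span ?F"
    unfolding span_Z by (intro span_minimal subsetI) auto
  moreover have "span ?F \<subseteq> span Z"
    using F_spec by (intro span_mono) blast
  ultimately show ?thesis
    using F_spec finite_G by (intro that[of ?F]) auto
qed

lemma noetherian_ascending_chain:
  assumes "noetherian X" "subspace X"
    and subspace_L: "\<And>n. subspace (L n)" and mono_L: "mono L" and L_subset: "\<And>n. L n \<subseteq> X"
  obtains k where "\<And>n::nat. L n \<subseteq> L k"
proof -
  have "(\<Union>n. L n) \<subseteq> X" using L_subset by blast
  then obtain F where finite_F: "finite F" and F_subset: "F \<subseteq> (\<Union>n. L n)"
      and span_F: "span (\<Union>n. L n) = span F"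
    by (rule noetherian_span_eq_span_finite[OF assms(1,2)])
  have "subset.chain UNIV (range L)"
    unfolding subset_chain_def using monoD[OF mono_L] nat_le_linear by blast
  then obtain k where "F \<subseteq> L k"
    using finite_subset_Union_chain[OF finite_F F_subset] by blast
  then have "(\<Union>n. L n) \<subseteq> L k"
    using span_F span_superset span_minimal[OF _ subspace_L] by blast
  then show ?thesis using that by blast
qed

lemma noetherian_maximal:
  assumes "noetherian X" "subspace X" and "\<A> \<noteq> {}" "\<And>Y. Y \<in> \<A> \<Longrightarrow> subspace Y \<and> Y \<subseteq> X"
  obtains Y where "Y \<in> \<A>" "\<And>Z. Z \<in> \<A> \<Longrightarrow> Y \<subseteq> Z \<Longrightarrow> Z = Y"
proof (rule ccontr)
  assume "\<not> thesis"
  then have "\<forall>Y\<in>\<A>. \<exists>Z\<in>\<A>. Y \<subset> Z" using that by blast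
  moreover obtain Y0 where "Y0 \<in> \<A>" using assms(3) by blast
  ultimately obtain L where L_mem: "\<And>n::nat. L n \<in> \<A>" and L_strict: "\<And>n. L n \<subset> L (Suc n)"
    using dependent_nat_choice[of "\<lambda>n Y. Y \<in> \<A>" "\<lambda>n Y Z. Y \<subset> Z"] by (metis (no_types))
  obtain k where "\<And>n. L n \<subseteq> L k"
    using noetherian_ascending_chain[OF assms(1,2), of L] assms(4) L_mem L_strict
    by (metis mono_iff_le_Suc psubset_imp_subset)
  with L_strict[of k] show False by blast
qed

lemma mem_colon_iff: "c \<in> colon L x \<longleftrightarrow> c *s x \<in> L"
  by (simp add: colon_def)

lemma ideal_colon:
  assumes "subspace L"
  shows "ideal (colon L x)"
  using module_hom.subspace_vimage[OF module_hom_scale_left assms, of x]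
  unfolding ideal_def colon_def vimage_def .

lemma fin_gen_extension:
  assumes subspace_Y: "subspace Y" and finite_G: "finite G" and G_subset: "G \<subseteq> Y"
    and subspace_N: "subspace N" and fin_gen_inter: "fin_gen scale (Y \<inter> N)" and "Y \<subseteq> span G \<oplus> N"
  shows "fin_gen scale Y"
proof -
  obtain H where finite_H: "finite H" and inter_eq: "Y \<inter> N = span H"
    using fin_gen_inter unfolding fin_gen_def by blast
  have "Y \<subseteq> (N \<oplus> span G) \<inter> Y"
    using assms(6) by (simp add: msum_commute)
  also have "\<dots> \<subseteq> (N \<inter> Y) \<oplus> span G"
    using subspace_Y G_subset subspace_N by (intro msum_modular span_minimal) auto
  also have "\<dots> = span (H \<union> G)"
    using inter_eq by (simp add: msum_def Int_commute span_Un span_span)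
  finally have "Y = span (H \<union> G)"
    using inter_eq G_subset subspace_Y span_base by (intro equalityI span_minimal) auto
  then show ?thesis
    unfolding fin_gen_def using finite_G finite_H by (intro exI[of _ "H \<union> G"]) simp
qed

lemma colon_generators_cover:
  assumes subspace_Y: "subspace Y" and subspace_N: "subspace N"
    and "finite C" "colon (Y \<oplus> N) x = ring.span C"
    and "\<And>v. v \<in> Y \<Longrightarrow> \<exists>c. v - c *s x \<in> N"
  obtains G where "finite G" "G \<subseteq> Y" "Y \<subseteq> span G \<oplus> N"
proof -
  have "\<exists>y\<in>Y. c *s x - y \<in> N" if "c \<in> C" for c
  proof -
    have "c *s x \<in> Y \<oplus> N"
      using ring.span_base[OF that] unfolding assms(4)[symmetric] mem_colon_iff .
    then obtain y n where "y \<in> Y" "n \<in> N" "c *s x = y + n"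
      using subspace_Y subspace_N by (rule msumE)
    then show ?thesis by (intro bexI[of _ y]) auto
  qed
  then obtain y where y_lifts: "\<And>c. c \<in> C \<Longrightarrow> y c \<in> Y \<and> c *s x - y c \<in> N" by metis
  have "y c + (c *s x - y c) \<in> span (y ` C) \<oplus> N" if "c \<in> C" for c
    using y_lifts[OF that] that by (intro msumI) (auto intro: span_base)
  then have lift: "ring.span C \<subseteq> (\<lambda>c. c *s x) -` (span (y ` C) \<oplus> N)"
    by (intro ring.span_minimal module_hom.subspace_vimage[OF module_hom_scale_left] subspace_msum)
      auto
  have "v \<in> span (y ` C) \<oplus> N" if v_mem: "v \<in> Y" for v
  proof -
    obtain c where v_congruent: "v - c *s x \<in> N" using assms(5)[OF v_mem] by blast
    have "v + - (v - c *s x) \<in> Y \<oplus> N"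
      using v_mem subspace_N v_congruent by (intro msumI subspace_neg)
    then have "c *s x \<in> span (y ` C) \<oplus> N"
      using lift assms(4) by (auto simp: mem_colon_iff)
    moreover have "v - c *s x \<in> span (y ` C) \<oplus> N"
      using v_congruent msum_upper2 by auto
    ultimately have "c *s x + (v - c *s x) \<in> span (y ` C) \<oplus> N"
      by (rule subspace_add[OF subspace_msum])
    then show ?thesis by simp
  qed
  with y_lifts assms(3) show ?thesis by (intro that[of "y ` C"]) auto
qed

text \<open>A submodule of \<open>Rx + N\<close> is generated by its intersection with \<open>N\<close> together with elements
  congruent to \<open>c x\<close> modulo \<open>N\<close>, where \<open>c\<close> runs through generators of its ideal of
  \<open>x\<close>-coefficients.\<close>

lemma noetherian_span_finite:
  assumes noetherian_R: "noetherian_ring TYPE('a)" and "finite F"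
  shows "noetherian (span F)"
  using assms(2)
proof (induction F)
  case empty
  have "fin_gen scale Y" if "subspace Y" "Y \<subseteq> {0}" for Y
    using that subspace_0[of Y] unfolding fin_gen_def by (intro exI[of _ "{}"]) auto
  then show ?case unfolding noetherian_def by simp
next
  case (insert x F)
  show ?case unfolding noetherian_def
  proof (intro allI impI)
    fix Y assume subspace_Y: "subspace Y" and Y_subset: "Y \<subseteq> span (insert x F)"
    obtain C where finite_C: "finite C" and colon_eq: "colon (Y \<oplus> span F) x = ring.span C"
      using noetherian_R ideal_colon[OF subspace_msum, of Y "span F" x]
      unfolding noetherian_ring_def by auto
    have "\<exists>c. v - c *s x \<in> span F" if "v \<in> Y" for v
      using that Y_subset span_breakdown_eq by blast
    then obtain G where finite_G: "finite G" and G_subset: "G \<subseteq> Y"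
        and Y_covered: "Y \<subseteq> span G \<oplus> span F"
      by (rule colon_generators_cover[OF subspace_Y subspace_span finite_C colon_eq])
    have "fin_gen scale (Y \<inter> span F)"
      using insert.IH subspace_Y unfolding noetherian_def by (simp add: subspace_inter)
    then show "fin_gen scale Y"
      by (rule fin_gen_extension[OF subspace_Y finite_G G_subset subspace_span _ Y_covered])
  qed
qed

lemma noetherian_fin_gen:
  "noetherian_ring TYPE('a) \<Longrightarrow> fin_gen scale X \<Longrightarrow> noetherian X"
  using noetherian_span_finite unfolding fin_gen_def by blast

end

section \<open>The Artin-Rees lemma\<close>

text \<open>A Rees family is a graded module over the Rees ring \<open>\<Oplus>\<^sub>n A\<^sup>n t\<^sup>n\<close>, given by its graded
  components; the second notion means generation in bounded degrees modulo \<open>P\<close>.\<close>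

definition (in module) rees_family :: "'a set \<Rightarrow> (nat \<Rightarrow> 'b set) \<Rightarrow> bool" where
  "rees_family A S \<longleftrightarrow> (\<forall>n. subspace (S n)) \<and> (\<forall>n. A \<odot> S n \<subseteq> S (Suc n))"

definition (in module) eventually_generated ::
  "'a set \<Rightarrow> (nat \<Rightarrow> 'b set) \<Rightarrow> (nat \<Rightarrow> 'b set) \<Rightarrow> bool" where
  "eventually_generated A P S \<longleftrightarrow>
     (\<forall>\<^sub>F n in sequentially. S (Suc n) \<subseteq> P (Suc n) \<oplus> A \<odot> S n)"

context module
begin

lemma rees_familyI:
  assumes "\<And>n. subspace (S n)" and "\<And>a x n. a \<in> A \<Longrightarrow> x \<in> S n \<Longrightarrow> a *s x \<in> S (Suc n)"
  shows "rees_family A S"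
  unfolding rees_family_def using assms by (intro conjI allI smod_least)

lemma rees_family_subspace: "rees_family A S \<Longrightarrow> subspace (S n)"
  unfolding rees_family_def by blast

lemma rees_family_smod: "rees_family A S \<Longrightarrow> A \<odot> S n \<subseteq> S (Suc n)"
  unfolding rees_family_def by blast

lemma rees_family_scale: "rees_family A S \<Longrightarrow> a \<in> A \<Longrightarrow> x \<in> S n \<Longrightarrow> a *s x \<in> S (Suc n)"
  using rees_family_smod smodI by blast

lemma rees_family_scale_power:
  assumes "rees_family A S" "a \<in> A" "x \<in> S n"
  shows "a ^ k *s x \<in> S (n + k)"
proof (induction k)
  case (Suc k)
  then have "a *s (a ^ k *s x) \<in> S (Suc (n + k))"
    by (rule rees_family_scale[OF assms(1,2)])
  then show ?case by simp
qed (simp add: assms(3))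

lemma rees_family_antimono: "rees_family B S \<Longrightarrow> A \<subseteq> B \<Longrightarrow> rees_family A S"
  unfolding rees_family_def using smod_mono by blast

lemma rees_family_const: "subspace X \<Longrightarrow> rees_family A (\<lambda>n. X)"
  by (simp add: rees_family_def smod_subset)

lemma rees_family_inter: "rees_family A S \<Longrightarrow> rees_family A T \<Longrightarrow> rees_family A (\<lambda>n. S n \<inter> T n)"
  by (intro rees_familyI subspace_inter) (auto intro: rees_family_subspace rees_family_scale)

lemma rees_family_msum:
  assumes "rees_family A S" "rees_family A T"
  shows "rees_family A (\<lambda>n. S n \<oplus> T n)"
  unfolding rees_family_def
  using assms by (simp add: subspace_msum smod_msum rees_family_subspace msum_mono rees_family_smod)

lemma rees_family_smod_const:
  assumes "rees_family A S"
  shows "rees_family A (\<lambda>n. B \<odot> S n)"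
proof -
  have "A \<odot> (B \<odot> S n) \<subseteq> B \<odot> S (Suc n)" for n
    using smod_smod_subset smod_mono[OF order_refl rees_family_smod[OF assms]] by blast
  then show ?thesis by (simp add: rees_family_def subspace_smod)
qed

lemma subspace_UN_mono:
  assumes "\<And>k. subspace (L k)" and "mono L"
  shows "subspace (\<Union>k::nat. L k)"
proof (rule subspaceI)
  fix x y assume "x \<in> (\<Union>k. L k)" "y \<in> (\<Union>k. L k)"
  then obtain j k where "x \<in> L j" "y \<in> L k" by blast
  then have "x \<in> L (max j k)" "y \<in> L (max j k)"
    using monoD[OF assms(2), of j "max j k"] monoD[OF assms(2), of k "max j k"] by auto
  then show "x + y \<in> (\<Union>k. L k)" using assms(1) subspace_add by blast
next
  show "0 \<in> (\<Union>k. L k)" using subspace_0[OF assms(1)] by blast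
  show "c *s x \<in> (\<Union>k. L k)" if "x \<in> (\<Union>k. L k)" for c x
    using that subspace_scale[OF assms(1)] by blast
qed

lemma rees_family_UN_mono:
  assumes "\<And>k. rees_family A (C k)" and "\<And>n. mono (\<lambda>k. C k n)"
  shows "rees_family A (\<lambda>n. \<Union>k::nat. C k n)"
  using assms
  by (intro rees_familyI subspace_UN_mono) (blast intro: rees_family_subspace rees_family_scale)+

lemma rees_chain_stabilizes:
  assumes rees_C: "\<And>k. rees_family A (C k)" and mono_C: "\<And>n. mono (\<lambda>k. C k n)"
    and noetherian_M: "\<And>n. noetherian (M n)" and subspace_M: "\<And>n. subspace (M n)"
    and P_subset: "\<And>k n. P n \<subseteq> C k n" and C_subset: "\<And>k n. C k n \<subseteq> M n"
    and "eventually_generated A P (\<lambda>n. \<Union>k::nat. C k n)"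
  obtains K where "\<And>k n. C k n \<subseteq> C K n"
proof -
  obtain d where generated_from: "(\<Union>k. C k (Suc n)) \<subseteq> P (Suc n) \<oplus> A \<odot> (\<Union>k. C k n)" if "d \<le> n" for n
    using assms(7) unfolding eventually_generated_def eventually_sequentially by blast
  have "\<exists>j. \<forall>k. C k n \<subseteq> C j n" for n
    by (rule noetherian_ascending_chain[of "M n" "\<lambda>k. C k n",
          OF noetherian_M subspace_M rees_family_subspace[OF rees_C] mono_C C_subset]) blast
  then obtain j where stable_at: "\<And>k n. C k n \<subseteq> C (j n) n" by metis
  define K where "K = Max (j ` {..d})"
  have low: "C k n \<subseteq> C K n" if "n \<le> d" for k n
  proof -
    have "j n \<le> K" unfolding K_def using that by simp
    then show ?thesis using stable_at[of k n] monoD[OF mono_C, of "j n" K n] by blast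
  qed
  have "C k n \<subseteq> C K n" for k n
  proof (induction n arbitrary: k)
    case (Suc n)
    show ?case
    proof (cases "Suc n \<le> d")
      case False
      then have "C k (Suc n) \<subseteq> P (Suc n) \<oplus> A \<odot> (\<Union>k. C k n)" using generated_from[of n] by auto
      also have "\<dots> \<subseteq> P (Suc n) \<oplus> A \<odot> C K n"
        using Suc.IH by (intro msum_mono smod_mono order_refl) auto
      also have "\<dots> \<subseteq> C K (Suc n)"
        using rees_C P_subset by (intro msum_least rees_family_subspace rees_family_smod)
      finally show ?thesis .
    qed (rule low)
  qed (simp add: low)
  then show ?thesis by (rule that)
qed

end

text \<open>The induction step of Hilbert's basis argument, modelled on the fact that a graded ring
  \<open>B\<close> with a homogeneous element \<open>a\<close> of positive degree is Noetherian if \<open>B/aB\<close> is: \<open>multiples\<close> is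
  \<open>aM\<close> with its grading, and \<open>colon_mod k\<close> represents the image of \<open>(S : a\<^sup>k)\<close> in \<open>M/(P + aM)\<close>.\<close>

locale hilbert_step = module scale
  for scale :: "'a::comm_ring_1 \<Rightarrow> 'b::ab_group_add \<Rightarrow> 'b" (infixr "*s" 75) +
  fixes F :: "'a set" and a :: 'a and M P S :: "nat \<Rightarrow> 'b set"
  assumes rees_M: "rees_family (insert a F) M"
    and rees_P: "rees_family (insert a F) P"
    and rees_S: "rees_family (insert a F) S"
    and P_subset_S: "P n \<subseteq> S n" and S_subset_M: "S n \<subseteq> M n"
begin

definition multiples :: "nat \<Rightarrow> 'b set" where
  "multiples n = (case n of 0 \<Rightarrow> {0} | Suc m \<Rightarrow> (*s) a ` M m)"

definition base_mod :: "nat \<Rightarrow> 'b set" where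
  "base_mod n = P n \<oplus> multiples n"

definition power_colon :: "nat \<Rightarrow> nat \<Rightarrow> 'b set" where
  "power_colon k n = M n \<inter> (*s) (a ^ k) -` S (n + k)"

definition colon_mod :: "nat \<Rightarrow> nat \<Rightarrow> 'b set" where
  "colon_mod k n = power_colon k n \<oplus> base_mod n"

lemma rees_multiples: "rees_family F multiples"
proof (rule rees_familyI)
  show "subspace (multiples n)" for n
    unfolding multiples_def
    using module_hom.subspace_image[OF module_hom_scale_self] rees_family_subspace[OF rees_M]
    by (simp split: nat.split)
  show "b *s x \<in> multiples (Suc n)" if "b \<in> F" "x \<in> multiples n" for b x n
  proof (cases n)
    case 0
    with that show ?thesis
      using subspace_0[OF rees_family_subspace[OF rees_M]] by (force simp: multiples_def)
  next
    case (Suc m)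
    with that obtain y where y_mem: "y \<in> M m" and "x = a *s y" by (auto simp: multiples_def)
    then have "b *s x = a *s (b *s y)" by (simp add: mult.commute)
    moreover have "b *s y \<in> M n"
      using rees_family_scale[OF rees_M] that(1) y_mem Suc by simp
    ultimately have "b *s x \<in> (*s) a ` M n" by (rule image_eqI)
    then show ?thesis by (simp add: multiples_def)
  qed
qed

lemma multiples_subset: "multiples n \<subseteq> M n"
  using rees_family_scale[OF rees_M] subspace_0[OF rees_family_subspace[OF rees_M]]
  by (auto simp: multiples_def split: nat.split)

lemma rees_base_mod: "rees_family F base_mod"
  unfolding base_mod_def
  by (intro rees_family_msum rees_multiples rees_family_antimono[OF rees_P] subset_insertI)

lemma base_mod_subset: "base_mod n \<subseteq> M n"
  unfolding base_mod_def
  by (intro msum_least rees_family_subspace[OF rees_M] multiples_subset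
      order_trans[OF P_subset_S S_subset_M])

lemma eventually_generated_base_mod:
  assumes "eventually_generated (insert a F) P M"
  shows "eventually_generated F base_mod M"
  using assms unfolding eventually_generated_def
proof eventually_elim
  case (elim n)
  have "insert a F \<odot> M n \<subseteq> base_mod (Suc n) \<oplus> F \<odot> M n"
  proof (intro smod_least subspace_msum)
    fix b x assume "b \<in> insert a F" "x \<in> M n"
    then have "b *s x \<in> multiples (Suc n) \<or> b *s x \<in> F \<odot> M n"
      by (auto simp: multiples_def intro: smodI)
    then show "b *s x \<in> base_mod (Suc n) \<oplus> F \<odot> M n"
      unfolding base_mod_def using msum_upper1 msum_upper2 by blast
  qed
  moreover have "P (Suc n) \<subseteq> base_mod (Suc n) \<oplus> F \<odot> M n"
    unfolding base_mod_def using msum_upper1 by blast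
  ultimately show ?case using elim msum_least[OF subspace_msum] by blast
qed

lemma subspace_power_colon: "subspace (power_colon k n)"
  unfolding power_colon_def
  by (intro subspace_inter module_hom.subspace_vimage[OF module_hom_scale_self]
      rees_family_subspace[OF rees_M] rees_family_subspace[OF rees_S])

lemma rees_power_colon: "rees_family F (power_colon k)"
proof (rule rees_familyI[OF subspace_power_colon])
  fix b x n assume "b \<in> F" "x \<in> power_colon k n"
  then show "b *s x \<in> power_colon k (Suc n)"
    unfolding power_colon_def
    using rees_family_scale[OF rees_M, of b x n]
      rees_family_scale[OF rees_S, of b "a ^ k *s x" "n + k"]
    by (simp add: mult.commute)
qed

lemma rees_colon_mod: "rees_family F (colon_mod k)"
  unfolding colon_mod_def by (intro rees_family_msum rees_power_colon rees_base_mod)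

lemma colon_mod_subset: "colon_mod k n \<subseteq> M n"
  unfolding colon_mod_def using base_mod_subset
  by (intro msum_least rees_family_subspace[OF rees_M]) (auto simp: power_colon_def)

lemma mono_colon_mod: "mono (\<lambda>k. colon_mod k n)"
proof -
  have "power_colon k n \<subseteq> power_colon (Suc k) n" for k
    unfolding power_colon_def using rees_family_scale[OF rees_S, of a _ "n + k"]
    by (auto simp flip: scale_scale)
  then show ?thesis
    unfolding mono_iff_le_Suc colon_mod_def by (intro allI msum_mono order_refl)
qed

lemma power_colon_subset_of_generated:
  assumes "colon_mod k (Suc i) \<subseteq> base_mod (Suc i) \<oplus> F \<odot> colon_mod k i"
  shows "power_colon k (Suc i) \<subseteq> base_mod (Suc i) \<oplus> (*s) (a ^ k) -` (insert a F \<odot> S (i + k))"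
    (is "_ \<subseteq> _ \<oplus> ?Q")
proof -
  have "F \<odot> power_colon k i \<subseteq> ?Q"
  proof (intro smod_least module_hom.subspace_vimage[OF module_hom_scale_self] subspace_smod)
    fix b x assume "b \<in> F" "x \<in> power_colon k i"
    then have "b *s (a ^ k *s x) \<in> insert a F \<odot> S (i + k)"
      by (intro smodI) (auto simp: power_colon_def)
    then show "b *s x \<in> ?Q" by (simp add: mult.commute)
  qed
  then have "F \<odot> colon_mod k i \<subseteq> ?Q \<oplus> base_mod (Suc i)"
    unfolding colon_mod_def
      smod_msum[OF subspace_power_colon rees_family_subspace[OF rees_base_mod]]
    by (intro msum_mono rees_family_smod[OF rees_base_mod])
  then have "base_mod (Suc i) \<oplus> F \<odot> colon_mod k i \<subseteq> base_mod (Suc i) \<oplus> ?Q"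
    by (intro msum_least subspace_msum msum_upper1) (simp add: msum_commute)
  moreover have "power_colon k (Suc i) \<subseteq> colon_mod k (Suc i)"
    unfolding colon_mod_def by (rule msum_upper1)
  ultimately show ?thesis using assms by blast
qed

lemma power_colon_subset_of_stable:
  assumes "colon_mod (Suc l) j \<subseteq> colon_mod l j"
  shows "power_colon (Suc l) j \<subseteq> base_mod j \<oplus> (*s) (a ^ Suc l) -` (insert a F \<odot> S (j + l))"
    (is "_ \<subseteq> _ \<oplus> ?Q")
proof -
  have "power_colon l j \<subseteq> ?Q"
    unfolding power_colon_def by (auto intro: smodI simp flip: scale_scale)
  then have "colon_mod l j \<subseteq> base_mod j \<oplus> ?Q"
    unfolding colon_mod_def
    by (intro msum_least subspace_msum msum_upper1) (use msum_upper2 in blast)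
  moreover have "power_colon (Suc l) j \<subseteq> colon_mod (Suc l) j"
    unfolding colon_mod_def by (rule msum_upper1)
  ultimately show ?thesis using assms by blast
qed

lemma power_colon_subset:
  assumes stable: "\<And>k n. colon_mod k n \<subseteq> colon_mod K n"
    and generated: "\<And>k n. k \<le> K \<Longrightarrow> c \<le> n \<Longrightarrow>
      colon_mod k (Suc n) \<subseteq> base_mod (Suc n) \<oplus> F \<odot> colon_mod k n"
    and "K + c \<le> n" "j + k = Suc n"
  shows "power_colon k j \<subseteq> base_mod j \<oplus> (*s) (a ^ k) -` (insert a F \<odot> S n)"
proof (cases "k \<le> K")
  case True
  then obtain i where "j = Suc i" "i + k = n" "c \<le> i"
    using assms(3,4) by (cases j) auto
  then show ?thesis
    using power_colon_subset_of_generated[OF generated[OF True]] by auto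
next
  case False
  then obtain l where "k = Suc l" "K \<le> l" "j + l = n"
    using assms(4) by (cases k) auto
  moreover have "colon_mod (Suc l) j \<subseteq> colon_mod l j"
    using stable[of "Suc l" j] monoD[OF mono_colon_mod \<open>K \<le> l\<close>, of j] by blast
  ultimately show ?thesis using power_colon_subset_of_stable[of l j] by simp
qed

lemma power_multiple_reduce:
  assumes "power_colon k j \<subseteq> base_mod j \<oplus> (*s) (a ^ k) -` (insert a F \<odot> S n)"
    and "j + k = Suc n" "m \<in> M j" "a ^ k *s m \<in> S (Suc n)"
  obtains r where "r \<in> multiples j" "a ^ k *s m - a ^ k *s r \<in> P (Suc n) \<oplus> insert a F \<odot> S n"
proof -
  have "m \<in> base_mod j \<oplus> (*s) (a ^ k) -` (insert a F \<odot> S n)"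
    using assms by (auto simp: power_colon_def)
  then obtain p q where p_mem: "p \<in> base_mod j" and q_mem: "a ^ k *s q \<in> insert a F \<odot> S n"
      and m_eq: "m = p + q"
    by (rule msumE) (auto intro: rees_family_subspace[OF rees_base_mod] subspace_smod
        module_hom.subspace_vimage[OF module_hom_scale_self])
  from p_mem obtain x r where x_mem: "x \<in> P j" and r_mem: "r \<in> multiples j" and p_eq: "p = x + r"
    unfolding base_mod_def
    by (rule msumE) (rule rees_family_subspace rees_P rees_multiples)+
  have "a ^ k *s x \<in> P (Suc n)"
    using rees_family_scale_power[OF rees_P insertI1 x_mem, of k] assms(2) by simp
  then have "a ^ k *s x + a ^ k *s q \<in> P (Suc n) \<oplus> insert a F \<odot> S n"
    using q_mem by (rule msumI)
  with r_mem p_eq m_eq show ?thesis by (intro that[of r]) (auto simp: algebra_simps)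
qed

text \<open>The degree \<open>j\<close> drops by one at each reduction, and there are no multiples in degree zero.\<close>

lemma power_multiple_mem:
  assumes decompose: "\<And>j k. j + k = Suc n \<Longrightarrow>
      power_colon k j \<subseteq> base_mod j \<oplus> (*s) (a ^ k) -` (insert a F \<odot> S n)"
    and "j + k = Suc n" "m \<in> M j" "a ^ k *s m \<in> S (Suc n)"
  shows "a ^ k *s m \<in> P (Suc n) \<oplus> insert a F \<odot> S n" (is "_ \<in> ?G")
  using assms(2-)
proof (induction j arbitrary: k m)
  case 0
  obtain r where "r \<in> multiples 0" "a ^ k *s m - a ^ k *s r \<in> ?G"
    by (rule power_multiple_reduce[OF decompose[OF "0"(1)] "0"])
  then show ?case by (simp add: multiples_def)
next
  case (Suc i)
  obtain r where "r \<in> multiples (Suc i)" "a ^ k *s m - a ^ k *s r \<in> ?G"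
    by (rule power_multiple_reduce[OF decompose[OF Suc.prems(1)] Suc.prems])
  then obtain y where y_mem: "y \<in> M i" and y_diff: "a ^ k *s m - a ^ Suc k *s y \<in> ?G"
    by (auto simp: multiples_def mult.commute)
  have "?G \<subseteq> S (Suc n)"
    by (intro msum_least rees_family_subspace[OF rees_S] P_subset_S rees_family_smod[OF rees_S])
  then have "a ^ k *s m - (a ^ k *s m - a ^ Suc k *s y) \<in> S (Suc n)"
    using y_diff subspace_diff[OF rees_family_subspace[OF rees_S] Suc.prems(3)] by blast
  then have "a ^ Suc k *s y \<in> ?G"
    using Suc.prems(1) y_mem by (intro Suc.IH) auto
  with y_diff have "(a ^ k *s m - a ^ Suc k *s y) + a ^ Suc k *s y \<in> ?G"
    by (intro subspace_add subspace_msum)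
  then show ?case by simp
qed

lemma eventually_generated_insert:
  assumes noetherian_M: "\<And>n. noetherian (M n)"
    and generated_mod_a: "\<And>T. rees_family F T \<Longrightarrow> (\<And>n. base_mod n \<subseteq> T n) \<Longrightarrow> (\<And>n. T n \<subseteq> M n) \<Longrightarrow>
      eventually_generated F base_mod T"
  shows "eventually_generated (insert a F) P S"
proof -
  have base_mod_subset_colon_mod: "base_mod n \<subseteq> colon_mod k n" for k n
    unfolding colon_mod_def by (rule msum_upper2)
  have "eventually_generated F base_mod (\<lambda>n. \<Union>k. colon_mod k n)"
    using base_mod_subset_colon_mod colon_mod_subset
    by (intro generated_mod_a rees_family_UN_mono rees_colon_mod mono_colon_mod) blast+
  then obtain K where stable_at_K: "\<And>k n. colon_mod k n \<subseteq> colon_mod K n"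
    by (rule rees_chain_stabilizes[OF rees_colon_mod mono_colon_mod noetherian_M
          rees_family_subspace[OF rees_M] base_mod_subset_colon_mod colon_mod_subset]) blast
  have "\<forall>\<^sub>F n in sequentially. \<forall>k\<in>{..K}. colon_mod k (Suc n) \<subseteq> base_mod (Suc n) \<oplus> F \<odot> colon_mod k n"
    using generated_mod_a[OF rees_colon_mod base_mod_subset_colon_mod colon_mod_subset]
    unfolding eventually_generated_def
    by (intro eventually_ball_finite) auto
  then obtain c where generated_from: "\<And>k n. k \<le> K \<Longrightarrow> c \<le> n \<Longrightarrow>
      colon_mod k (Suc n) \<subseteq> base_mod (Suc n) \<oplus> F \<odot> colon_mod k n"
    unfolding eventually_sequentially by blast
  have "S (Suc n) \<subseteq> P (Suc n) \<oplus> insert a F \<odot> S n" if "K + c \<le> n" for n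
  proof
    fix s assume "s \<in> S (Suc n)"
    then show "s \<in> P (Suc n) \<oplus> insert a F \<odot> S n"
      using power_multiple_mem[OF power_colon_subset[OF stable_at_K generated_from that],
          of "Suc n" 0 s] S_subset_M by auto
  qed
  then show ?thesis
    unfolding eventually_generated_def eventually_sequentially by blast
qed

end

context module
begin

lemma eventually_generated_subfamily_finite:
  assumes "finite F" and rees_M: "rees_family F M" and noetherian_M: "\<And>n. noetherian (M n)"
    and rees_P: "rees_family F P" and generated_M: "eventually_generated F P M"
    and rees_S: "rees_family F S" and P_subset: "\<And>n. P n \<subseteq> S n" and S_subset: "\<And>n. S n \<subseteq> M n"
  shows "eventually_generated F P S"
  using assms(1) rees_M rees_P generated_M rees_S P_subset S_subset
proof (induction F arbitrary: P S)
  case empty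
  show ?case
    using empty.prems(3) unfolding eventually_generated_def
    by eventually_elim (use empty.prems(6) in \<open>auto simp: smod_empty\<close>)
next
  case (insert a F)
  interpret hilbert_step scale F a M P S
    using insert.prems by unfold_locales
  have "eventually_generated F base_mod T"
    if "rees_family F T" "\<And>n. base_mod n \<subseteq> T n" "\<And>n. T n \<subseteq> M n" for T
    by (rule insert.IH[OF rees_family_antimono[OF rees_M subset_insertI] rees_base_mod
          eventually_generated_base_mod[OF insert.prems(3)] that])
  then show ?case by (rule eventually_generated_insert[OF noetherian_M])
qed

text \<open>The classical lemma is the case \<open>M n = I\<^sup>n X\<close>, \<open>P n = 0\<close>, \<open>S n = Y \<inter> I\<^sup>n X\<close>.\<close>

theorem artin_rees:
  assumes "noetherian_ring TYPE('a)" and "ideal I"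
    and rees_M: "rees_family I M" and noetherian_M: "\<And>n. noetherian (M n)"
    and rees_P: "rees_family I P" and generated_M: "eventually_generated I P M"
    and rees_S: "rees_family I S" and P_subset: "\<And>n. P n \<subseteq> S n" and S_subset: "\<And>n. S n \<subseteq> M n"
  shows "eventually_generated I P S"
proof -
  obtain F where finite_F: "finite F" and I_eq: "I = ring.span F"
    using assms(1,2) unfolding noetherian_ring_def by blast
  have I_smod_eq: "I \<odot> X = F \<odot> X" if "subspace X" for X
    unfolding I_eq using that by (rule smod_span)
  have rees: "rees_family F T" if "rees_family I T" for T
    using that rees_family_antimono ring.span_superset[of F] unfolding I_eq by blast
  have generated: "eventually_generated I P T \<longleftrightarrow> eventually_generated F P T"
    if "rees_family I T" for T
    unfolding eventually_generated_def using I_smod_eq rees_family_subspace[OF that] by simp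
  have "eventually_generated F P M"
    using generated_M generated[OF rees_M] by blast
  then have "eventually_generated F P S"
    by (rule eventually_generated_subfamily_finite[OF finite_F rees[OF rees_M] noetherian_M
          rees[OF rees_P] _ rees[OF rees_S] P_subset S_subset])
  then show ?thesis using generated[OF rees_S] by blast
qed

end

section \<open>Eventual constancy of inclusions\<close>

definition eventually_const :: "(nat \<Rightarrow> 'c) \<Rightarrow> bool" where
  "eventually_const f \<longleftrightarrow> (\<exists>c. \<forall>\<^sub>F n in sequentially. f n = c)"

lemma eventually_const_comp:
  assumes "eventually_const f" "eventually_const g"
  shows "eventually_const (\<lambda>n. h (f n) (g n))"
proof -
  obtain c d where "\<forall>\<^sub>F n in sequentially. f n = c" "\<forall>\<^sub>F n in sequentially. g n = d"
    using assms unfolding eventually_const_def by blast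
  then have "\<forall>\<^sub>F n in sequentially. h (f n) (g n) = h c d"
    by eventually_elim simp
  then show ?thesis unfolding eventually_const_def by blast
qed

lemma eventually_const_finite_Collect:
  assumes "finite A" and "\<And>i. i \<in> A \<Longrightarrow> eventually_const (P i)"
  shows "eventually_const (\<lambda>n. {i \<in> A. P i n})"
proof -
  obtain c where "\<And>i. i \<in> A \<Longrightarrow> \<forall>\<^sub>F n in sequentially. P i n = c i"
    using assms(2) unfolding eventually_const_def by metis
  then have "\<forall>\<^sub>F n in sequentially. \<forall>i\<in>A. P i n = c i"
    using assms(1) by (intro eventually_ball_finite) auto
  then have "\<forall>\<^sub>F n in sequentially. {i \<in> A. P i n} = {i \<in> A. c i}"
    by eventually_elim auto
  then show ?thesis unfolding eventually_const_def by blast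
qed

lemma eventually_const_ascending:
  assumes "\<forall>\<^sub>F n in sequentially. P n \<longrightarrow> P (Suc n)"
  shows "eventually_const P"
proof -
  obtain m where ascends: "\<And>n. m \<le> n \<Longrightarrow> P n \<Longrightarrow> P (Suc n)"
    using assms unfolding eventually_sequentially by blast
  show ?thesis
  proof (cases "\<exists>n\<ge>m. P n")
    case True
    then obtain k where m_le_k: "m \<le> k" and P_k: "P k" by blast
    have "P n" if "k \<le> n" for n
      using that m_le_k P_k by (induction rule: dec_induct) (auto intro: ascends)
    then show ?thesis unfolding eventually_const_def eventually_sequentially by blast
  next
    case False
    then show ?thesis unfolding eventually_const_def eventually_sequentially by blast
  qed
qed

definition (in module) stable_family :: "'a set \<Rightarrow> 'b set \<Rightarrow> (nat \<Rightarrow> 'b set) \<Rightarrow> bool" where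
  "stable_family A U S \<longleftrightarrow> subspace U \<and> (\<forall>n. U \<subseteq> S n) \<and> rees_family A S \<and>
     eventually_generated A (\<lambda>n. U) S"

context module
begin

lemma stable_family_base: "stable_family A U S \<Longrightarrow> subspace U"
  and stable_family_base_subset: "stable_family A U S \<Longrightarrow> U \<subseteq> S n"
  and stable_family_rees: "stable_family A U S \<Longrightarrow> rees_family A S"
  and stable_family_generated: "stable_family A U S \<Longrightarrow> eventually_generated A (\<lambda>n. U) S"
  unfolding stable_family_def by blast+

lemma rees_family_ideal_pow:
  assumes "subspace V"
  shows "rees_family A (\<lambda>n. ideal_pow A n \<odot> V)"
  unfolding rees_family_def smod_ideal_pow_Suc[OF assms] by (simp add: subspace_smod)

lemma antimono_ideal_pow:
  assumes "subspace V"
  shows "antimono (\<lambda>n. ideal_pow A n \<odot> V)"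
  unfolding antimono_iff_le_Suc smod_ideal_pow_Suc[OF assms]
  by (simp add: smod_subset subspace_smod)

lemma stable_family_msum_ideal_pow:
  assumes "subspace U" "subspace V"
  shows "stable_family A U (\<lambda>n. U \<oplus> ideal_pow A n \<odot> V)"
proof -
  have "U \<oplus> A \<odot> (ideal_pow A n \<odot> V) \<subseteq> U \<oplus> A \<odot> (U \<oplus> ideal_pow A n \<odot> V)" for n
    by (intro msum_mono smod_mono order_refl msum_upper2)
  then show ?thesis
    unfolding stable_family_def eventually_generated_def smod_ideal_pow_Suc[OF assms(2)]
    by (intro conjI allI assms msum_upper1 always_eventually rees_family_msum rees_family_const
        rees_family_ideal_pow)
qed

lemma stable_family_ideal_pow:
  assumes "subspace V"
  shows "stable_family A {0} (\<lambda>n. ideal_pow A n \<odot> V)"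
proof -
  have "{0} \<oplus> ideal_pow A n \<odot> V = ideal_pow A n \<odot> V" for n
    using msum_absorb1[OF subspace_smod, of "{0}"] subspace_0[OF subspace_smod]
    by (simp add: msum_commute[of "{0}"])
  then show ?thesis
    using stable_family_msum_ideal_pow[OF subspace_single_0 assms, of A] by simp
qed

lemma eventually_generated_trans:
  assumes generated_S: "eventually_generated A P S" and P_subset: "\<And>n. P n \<subseteq> S n"
    and generated_P: "eventually_generated A Q P"
  shows "eventually_generated A Q S"
  using generated_S generated_P unfolding eventually_generated_def
proof eventually_elim
  case (elim n)
  have "P (Suc n) \<subseteq> Q (Suc n) \<oplus> A \<odot> S n"
    using elim(2) msum_mono[OF order_refl smod_mono[OF order_refl P_subset]] by blast
  then show ?case
    using elim(1) msum_least[OF subspace_msum _ msum_upper2] by blast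
qed

lemma eventually_generated_inter:
  assumes subspace_U: "subspace U" and rees_S: "rees_family A S"
    and "eventually_generated A (\<lambda>n. U) (\<lambda>n. U \<oplus> S n)"
  shows "eventually_generated A (\<lambda>n. U \<inter> S n) S"
  using assms(3) unfolding eventually_generated_def
proof eventually_elim
  case (elim n)
  have "A \<odot> (U \<oplus> S n) \<subseteq> U \<oplus> A \<odot> S n"
    unfolding smod_msum[OF subspace_U rees_family_subspace[OF rees_S]]
    by (intro msum_mono smod_subset subspace_U order_refl)
  then have "U \<oplus> A \<odot> (U \<oplus> S n) \<subseteq> U \<oplus> A \<odot> S n"
    by (rule msum_least[OF subspace_msum msum_upper1])
  then have "S (Suc n) \<subseteq> (U \<oplus> A \<odot> S n) \<inter> S (Suc n)"
    using elim msum_upper2[of "S (Suc n)" U] by blast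
  also have "\<dots> \<subseteq> (U \<inter> S (Suc n)) \<oplus> A \<odot> S n"
    by (intro msum_modular subspace_U subspace_smod rees_family_subspace[OF rees_S]
        rees_family_smod[OF rees_S])
  finally show ?case .
qed

lemma eventually_const_stable_subset:
  assumes U_subset: "\<And>n. U \<subseteq> Z n" and generated_Z: "eventually_generated A (\<lambda>n. U) Z"
    and rees_B: "rees_family A B" and antimono_B: "antimono B"
  shows "eventually_const (\<lambda>n. Z n \<subseteq> B n)"
proof (cases "\<forall>n. U \<subseteq> B n")
  case True
  have "\<forall>\<^sub>F n in sequentially. Z n \<subseteq> B n \<longrightarrow> Z (Suc n) \<subseteq> B (Suc n)"
    using generated_Z unfolding eventually_generated_def
  proof eventually_elim
    case (elim n)
    show ?case
    proof
      assume "Z n \<subseteq> B n"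
      then have "A \<odot> Z n \<subseteq> B (Suc n)"
        using smod_mono rees_family_smod[OF rees_B] by blast
      with elim show "Z (Suc n) \<subseteq> B (Suc n)"
        using msum_least[OF rees_family_subspace[OF rees_B]] True by blast
    qed
  qed
  then show ?thesis by (rule eventually_const_ascending)
next
  case False
  then obtain m where not_subset: "\<not> U \<subseteq> B m" by blast
  have "\<not> Z n \<subseteq> B n" if "m \<le> n" for n
    using not_subset U_subset[of n] antimonoD[OF antimono_B that] by blast
  then show ?thesis unfolding eventually_const_def eventually_sequentially by blast
qed

end

context module_hom
begin

lemma rees_family_vimage: "m2.rees_family A S \<Longrightarrow> m1.rees_family A (\<lambda>n. f -` S n)"
  by (intro m1.rees_familyI subspace_vimage)
    (auto simp: scale intro: m2.rees_family_subspace m2.rees_family_scale)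

lemma rees_family_image: "m1.rees_family A S \<Longrightarrow> m2.rees_family A (\<lambda>n. f ` S n)"
  unfolding m1.rees_family_def m2.rees_family_def image_smod[symmetric]
  by (auto intro: subspace_image)

lemma eventually_generated_kernel:
  assumes rees_S: "m1.rees_family A S"
    and generated_image: "m2.eventually_generated A (\<lambda>n. {0}) (\<lambda>n. f ` S n)"
  shows "m1.eventually_generated A (\<lambda>n. S n \<inter> f -` {0}) S"
  using generated_image unfolding m1.eventually_generated_def m2.eventually_generated_def
proof eventually_elim
  case (elim n)
  show ?case
  proof
    fix x assume x_mem: "x \<in> S (Suc n)"
    have "{0} \<subseteq> smod s2 A (f ` S n)"
      using m2.subspace_0[OF m2.subspace_smod] by blast
    then have "msum s2 {0} (smod s2 A (f ` S n)) \<subseteq> smod s2 A (f ` S n)"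
      by (intro m2.msum_least m2.subspace_smod order_refl)
    with x_mem elim obtain y where y_mem: "y \<in> smod s1 A (S n)" and f_eq: "f x = f y"
      unfolding image_smod[symmetric] by blast
    have "y \<in> S (Suc n)"
      using y_mem m1.rees_family_smod[OF rees_S] by blast
    with x_mem f_eq have "x - y \<in> S (Suc n) \<inter> f -` {0}"
      by (simp add: diff m1.subspace_diff m1.rees_family_subspace[OF rees_S])
    then have "(x - y) + y \<in> msum s1 (S (Suc n) \<inter> f -` {0}) (smod s1 A (S n))"
      using y_mem by (rule m1.msumI)
    then show "x \<in> msum s1 (S (Suc n) \<inter> f -` {0}) (smod s1 A (S n))" by simp
  qed
qed

theorem eventually_generated_cocycles:
  assumes noetherian_R: "noetherian_ring TYPE('a)" and ideal_I: "ideal I"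
    and stable_N: "m1.stable_family I U N" and noetherian_N: "\<And>n. m1.noetherian (N n)"
    and stable_L: "m2.stable_family I {0} L" and noetherian_L: "\<And>n. m2.noetherian (L n)"
  shows "m1.eventually_generated I (\<lambda>n. U \<inter> f -` {0}) (\<lambda>n. N n \<inter> f -` L n)"
proof -
  let ?Z = "\<lambda>n. N n \<inter> f -` L n"
  note subspace_U = m1.stable_family_base[OF stable_N]
    and U_subset = m1.stable_family_base_subset[OF stable_N]
    and rees_N = m1.stable_family_rees[OF stable_N]
    and rees_L = m2.stable_family_rees[OF stable_L]
  have rees_Z: "m1.rees_family I ?Z"
    by (intro m1.rees_family_inter rees_N rees_family_vimage rees_L)
  have "m1.eventually_generated I (\<lambda>n. U) (\<lambda>n. msum s1 U (?Z n))"
    by (rule m1.artin_rees[OF noetherian_R ideal_I rees_N noetherian_N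
          m1.rees_family_const[OF subspace_U] m1.stable_family_generated[OF stable_N]])
      (intro m1.rees_family_msum m1.rees_family_const subspace_U U_subset rees_Z m1.msum_upper1
        m1.msum_least m1.rees_family_subspace[OF rees_N] Int_lower1)+
  then have generated_Z: "m1.eventually_generated I (\<lambda>n. U \<inter> ?Z n) ?Z"
    by (rule m1.eventually_generated_inter[OF subspace_U rees_Z])
  have rees_UZ: "m1.rees_family I (\<lambda>n. U \<inter> ?Z n)"
    by (intro m1.rees_family_inter m1.rees_family_const subspace_U rees_Z)
  have "m2.eventually_generated I (\<lambda>n. {0}) (\<lambda>n. f ` (U \<inter> ?Z n))"
  proof (rule m2.artin_rees[OF noetherian_R ideal_I rees_L noetherian_L
        m2.rees_family_const[OF m2.subspace_single_0] m2.stable_family_generated[OF stable_L]])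
    show "m2.rees_family I (\<lambda>n. f ` (U \<inter> ?Z n))"
      using rees_UZ by (rule rees_family_image)
    show "{0} \<subseteq> f ` (U \<inter> ?Z n)" for n
      using m2.subspace_0[OF subspace_image[OF m1.rees_family_subspace[OF rees_UZ]]] by blast
  qed blast
  then have "m1.eventually_generated I (\<lambda>n. U \<inter> ?Z n \<inter> f -` {0}) (\<lambda>n. U \<inter> ?Z n)"
    by (rule eventually_generated_kernel[OF rees_UZ])
  then have "m1.eventually_generated I (\<lambda>n. U \<inter> ?Z n \<inter> f -` {0}) ?Z"
    by (rule m1.eventually_generated_trans[OF generated_Z Int_lower2])
  moreover have "U \<inter> ?Z n \<inter> f -` {0} = U \<inter> f -` {0}" for n
    using U_subset m2.stable_family_base_subset[OF stable_L] by auto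
  ultimately show ?thesis by simp
qed

corollary eventually_const_cocycles_subset:
  assumes "noetherian_ring TYPE('a)" and "ideal I"
    and stable_N: "m1.stable_family I U N" and "\<And>n. m1.noetherian (N n)"
    and stable_L: "m2.stable_family I {0} L" and "\<And>n. m2.noetherian (L n)"
    and rees_B: "m1.rees_family I B" and antimono_B: "antimono B"
  shows "eventually_const (\<lambda>n. N n \<inter> f -` L n \<subseteq> B n)"
proof (rule m1.eventually_const_stable_subset[OF _ eventually_generated_cocycles[OF assms(1-6)]
      rees_B antimono_B])
  show "U \<inter> f -` {0} \<subseteq> N n \<inter> f -` L n" for n
    using m1.stable_family_base_subset[OF stable_N, of n]
      m2.stable_family_base_subset[OF stable_L, of n] by auto
qed

end

section \<open>Prime avoidance and zero divisors\<close>

lemma ideal_0: "ideal I \<Longrightarrow> 0 \<in> I"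
  and ideal_add: "ideal I \<Longrightarrow> a \<in> I \<Longrightarrow> b \<in> I \<Longrightarrow> a + b \<in> I"
  and ideal_diff: "ideal I \<Longrightarrow> a \<in> I \<Longrightarrow> b \<in> I \<Longrightarrow> a - b \<in> I"
  and ideal_mult: "ideal I \<Longrightarrow> a \<in> I \<Longrightarrow> c * a \<in> I"
  unfolding ideal_def
  by (rule ring.subspace_0 ring.subspace_add ring.subspace_diff ring.subspace_scale; assumption)+

definition prime_ideal :: "'a::comm_ring_1 set \<Rightarrow> bool" where
  "prime_ideal P \<longleftrightarrow> ideal P \<and> 1 \<notin> P \<and> (\<forall>a b. a * b \<in> P \<longrightarrow> a \<in> P \<or> b \<in> P)"

lemma prime_ideal_Inter_subset:
  assumes "prime_ideal P" "finite \<Q>" "\<And>Q. Q \<in> \<Q> \<Longrightarrow> ideal Q" "\<Inter>\<Q> \<subseteq> P"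
  shows "\<exists>Q\<in>\<Q>. Q \<subseteq> P"
  using assms(2-)
proof (induction \<Q>)
  case empty
  then show ?case using assms(1) unfolding prime_ideal_def by auto
next
  case (insert Q \<Q>)
  show ?case
  proof (cases "Q \<subseteq> P")
    case False
    then obtain q where q_mem: "q \<in> Q" and q_notin: "q \<notin> P" by blast
    have "w \<in> P" if "w \<in> \<Inter>\<Q>" for w
    proof -
      have "w * q \<in> Q" using ideal_mult[OF insert.prems(1) q_mem] by simp
      moreover have "w * q \<in> Q'" if "Q' \<in> \<Q>" for Q'
        using ideal_mult[of Q' w q] insert.prems(1)[of Q'] that \<open>w \<in> \<Inter>\<Q>\<close>
        by (auto simp: mult.commute)
      ultimately have "w * q \<in> P" using insert.prems(2) by blast
      then show ?thesis using q_notin assms(1) unfolding prime_ideal_def by blast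
    qed
    then show ?thesis using insert.IH insert.prems(1) by blast
  qed blast
qed

lemma prime_avoidance_insert:
  assumes ideal_J: "ideal J" and prime_P: "prime_ideal P" and "finite \<Q>"
    and ideals: "\<And>Q. Q \<in> \<Q> \<Longrightarrow> ideal Q" and not_subset: "\<And>Q. Q \<in> insert J \<Q> \<Longrightarrow> \<not> Q \<subseteq> P"
    and y_mem: "y \<in> J" and y_notin: "y \<notin> \<Union>\<Q>"
  shows "\<not> J \<subseteq> \<Union>(insert P \<Q>)"
proof (cases "y \<in> P")
  case True
  have "\<not> \<Inter>(insert J \<Q>) \<subseteq> P"
    using prime_ideal_Inter_subset[OF prime_P, of "insert J \<Q>"] assms(3) ideal_J ideals not_subset
    by auto
  then obtain w where w_mem: "w \<in> \<Inter>(insert J \<Q>)" and w_notin: "w \<notin> P" by blast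
  have "ideal P" using prime_P unfolding prime_ideal_def by blast
  then have "y + w \<notin> P"
    using ideal_diff[of P "y + w" y] True w_notin by auto
  moreover have "y + w \<notin> Q" if "Q \<in> \<Q>" for Q
    using ideal_diff[of Q "y + w" w] y_notin w_mem that ideals by auto
  moreover have "y + w \<in> J"
    using ideal_add[OF ideal_J y_mem] w_mem by simp
  ultimately show ?thesis by blast
next
  case False
  with y_mem y_notin show ?thesis by blast
qed

lemma prime_avoidance:
  assumes ideal_J: "ideal J" and "finite \<P>" "\<And>P. P \<in> \<P> \<Longrightarrow> prime_ideal P" "J \<subseteq> \<Union>\<P>"
  shows "\<exists>P\<in>\<P>. J \<subseteq> P"
  using assms(2-)
proof (induction \<P> rule: finite_psubset_induct)
  case (psubset \<P>)
  show ?case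
  proof (cases "\<exists>P\<in>\<P>. J \<subseteq> \<Union>(\<P> - {P})")
    case True
    then obtain P where "P \<in> \<P>" and covered: "J \<subseteq> \<Union>(\<P> - {P})" by blast
    then have "\<P> - {P} \<subset> \<P>" by blast
    then have "\<exists>Q\<in>\<P> - {P}. J \<subseteq> Q"
      by (rule psubset.IH[OF _ psubset.prems(1) covered]) simp
    then show ?thesis by blast
  next
    case irredundant: False
    obtain P where P_mem: "P \<in> \<P>" using ideal_0[OF ideal_J] psubset.prems(2) by blast
    then have insert_P: "insert P (\<P> - {P}) = \<P>" by blast
    obtain y where y_mem: "y \<in> J" and y_notin: "y \<notin> \<Union>(\<P> - {P})"
      using irredundant P_mem by blast
    have "\<not> Q \<subseteq> P" if "Q \<in> \<P> - {P}" for Q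
    proof
      assume "Q \<subseteq> P"
      then have "\<Union>\<P> \<subseteq> \<Union>(\<P> - {Q})" using that P_mem by blast
      then show False using irredundant that psubset.prems(2) by blast
    qed
    moreover have "ideal Q" if "Q \<in> \<P> - {P}" for Q
      using psubset.prems(1)[of Q] that unfolding prime_ideal_def by blast
    ultimately have "J \<subseteq> P"
      using prime_avoidance_insert[OF ideal_J psubset.prems(1)[OF P_mem] _ _ _ y_mem y_notin]
        psubset.hyps psubset.prems(2) insert_P by auto
    then show ?thesis using P_mem by blast
  qed
qed

lemma noetherian_ring_UNIV:
  "noetherian_ring TYPE('a::comm_ring_1) \<Longrightarrow> ring.noetherian (UNIV :: 'a set)"
  unfolding noetherian_ring_def ring.noetherian_def fin_gen_def ideal_def by blast

definition (in module) maximal_colon :: "'b set \<Rightarrow> 'b set \<Rightarrow> 'b \<Rightarrow> bool" where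
  "maximal_colon N L z \<longleftrightarrow>
     z \<in> N - L \<and> (\<forall>z'\<in>N - L. colon L z \<subseteq> colon L z' \<longrightarrow> colon L z' = colon L z)"

context module
begin

lemma prime_ideal_maximal_colon:
  assumes "subspace N" and subspace_L: "subspace L" and maximal_z: "maximal_colon N L z"
  shows "prime_ideal (colon L z)"
  unfolding prime_ideal_def
proof (intro conjI allI impI ideal_colon[OF subspace_L] disjCI)
  show "1 \<notin> colon L z" using maximal_z unfolding colon_def maximal_colon_def by simp
  fix a b assume prod_mem: "a * b \<in> colon L z" and b_notin: "b \<notin> colon L z"
  have "b *s z \<in> N - L"
    using b_notin maximal_z assms(1) unfolding maximal_colon_def colon_def
    by (auto simp: subspace_scale)
  moreover have "colon L z \<subseteq> colon L (b *s z)"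
    using subspace_scale[OF subspace_L]
    by (auto simp: colon_def scale_left_commute[of _ b] simp del: scale_scale)
  ultimately have "colon L (b *s z) = colon L z"
    using maximal_z unfolding maximal_colon_def by blast
  then show "a \<in> colon L z" using prod_mem unfolding colon_def by auto
qed

lemma maximal_colon_above:
  assumes "noetherian_ring TYPE('a)" and subspace_L: "subspace L" and z_mem: "z \<in> N - L"
  obtains z' where "maximal_colon N L z'" "colon L z \<subseteq> colon L z'"
proof -
  let ?\<A> = "colon L ` {z' \<in> N - L. colon L z \<subseteq> colon L z'}"
  obtain Y where Y_mem: "Y \<in> ?\<A>" and Y_maximal: "\<And>Y'. Y' \<in> ?\<A> \<Longrightarrow> Y \<subseteq> Y' \<Longrightarrow> Y' = Y"
  proof (rule ring.noetherian_maximal[OF noetherian_ring_UNIV[OF assms(1)] ring.subspace_UNIV,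
        of ?\<A>])
    show "?\<A> \<noteq> {}" using z_mem by blast
    show "ring.subspace Y \<and> Y \<subseteq> UNIV" if "Y \<in> ?\<A>" for Y
      using that ideal_colon[OF subspace_L] unfolding ideal_def by blast
  qed blast
  then obtain z' where "z' \<in> N - L" "Y = colon L z'" and colon_subset: "colon L z \<subseteq> colon L z'"
    by blast
  then have "maximal_colon N L z'"
    unfolding maximal_colon_def using Y_maximal by blast
  with colon_subset show ?thesis by (rule that[rotated])
qed

lemma finite_maximal_colons:
  assumes subspace_N: "subspace N" and noetherian_N: "noetherian N" and subspace_L: "subspace L"
  shows "finite (colon L ` Collect (maximal_colon N L))"
proof -
  have "Collect (maximal_colon N L) \<subseteq> N" unfolding maximal_colon_def by blast
  then obtain F where finite_F: "finite F" and F_subset: "F \<subseteq> Collect (maximal_colon N L)"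
      and span_F: "span (Collect (maximal_colon N L)) = span F"
    by (rule noetherian_span_eq_span_finite[OF noetherian_N subspace_N])
  have "colon L z \<in> colon L ` F" if maximal_z: "maximal_colon N L z" for z
  proof -
    have "\<Inter>(colon L ` F) \<subseteq> colon L z"
    proof
      fix c assume "c \<in> \<Inter>(colon L ` F)"
      then have "span F \<subseteq> (*s) c -` L"
        by (intro span_minimal module_hom.subspace_vimage[OF module_hom_scale_self] subspace_L)
          (auto simp: colon_def)
      moreover have "z \<in> span F"
        unfolding span_F[symmetric] using maximal_z by (intro span_base) simp
      ultimately show "c \<in> colon L z" by (auto simp: colon_def)
    qed
    then have "\<exists>Q\<in>colon L ` F. Q \<subseteq> colon L z"
      using finite_F ideal_colon[OF subspace_L]
      by (intro prime_ideal_Inter_subset[OF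
            prime_ideal_maximal_colon[OF subspace_N subspace_L maximal_z]]) auto
    then obtain x where x_mem: "x \<in> F" and "colon L x \<subseteq> colon L z" by blast
    then have "colon L z = colon L x"
      using F_subset maximal_z unfolding maximal_colon_def by blast
    with x_mem show ?thesis by blast
  qed
  then have "colon L ` Collect (maximal_colon N L) \<subseteq> colon L ` F" by blast
  then show ?thesis using finite_F by (rule finite_subset[OF _ finite_imageI])
qed

lemma ideal_of_zero_divisors_annihilates:
  assumes noetherian_R: "noetherian_ring TYPE('a)" and ideal_J: "ideal J"
    and subspace_N: "subspace N" and noetherian_N: "noetherian N" and subspace_L: "subspace L"
    and zero_divisors: "\<And>y. y \<in> J \<Longrightarrow> \<exists>z\<in>N - L. y *s z \<in> L"
  shows "\<exists>z\<in>N - L. J \<subseteq> colon L z"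
proof -
  let ?\<P> = "colon L ` Collect (maximal_colon N L)"
  have "J \<subseteq> \<Union>?\<P>"
  proof
    fix y assume "y \<in> J"
    then obtain z where z_mem: "z \<in> N - L" and y_colon: "y \<in> colon L z"
      using zero_divisors unfolding colon_def by blast
    obtain z' where "maximal_colon N L z'" "colon L z \<subseteq> colon L z'"
      using noetherian_R subspace_L z_mem by (rule maximal_colon_above)
    with y_colon show "y \<in> \<Union>?\<P>" by blast
  qed
  then have "\<exists>P\<in>?\<P>. J \<subseteq> P"
    using prime_ideal_maximal_colon[OF subspace_N subspace_L]
      finite_maximal_colons[OF subspace_N noetherian_N subspace_L]
    by (intro prime_avoidance[OF ideal_J]) auto
  then show ?thesis unfolding maximal_colon_def by blast
qed

end

section \<open>The Koszul complex\<close>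

text \<open>Words over the Booleans of length \<open>r\<close> encode the subsets of \<open>{1, \<dots>, r}\<close>, and a cochain with
  values in \<open>N\<close> is a function on words. Cochains in \<open>cochains r k N\<close> have degree \<open>k - 1\<close>; the
  shift makes \<open>k = 0\<close> the zero module in degree \<open>-1\<close>.\<close>

definition words :: "nat \<Rightarrow> nat \<Rightarrow> bool list set" where
  "words r k = {w. length w = r \<and> Suc (count_list w True) = k}"

definition cochains :: "nat \<Rightarrow> nat \<Rightarrow> 'b::zero set \<Rightarrow> (bool list \<Rightarrow> 'b) set" where
  "cochains r k N = {f. (\<forall>w\<in>words r k. f w \<in> N) \<and> (\<forall>w. w \<notin> words r k \<longrightarrow> f w = 0)}"

definition single :: "bool list \<Rightarrow> 'b::zero \<Rightarrow> bool list \<Rightarrow> 'b" where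
  "single w z = (\<lambda>v. if v = w then z else 0)"

text \<open>The recursion builds the complex as an iterated mapping cone of multiplications, so that no
  explicit signs occur; \<open>koszul_h\<close> with coefficients \<open>c\<^sub>1, \<dots>, c\<^sub>r\<close> is a homotopy between
  multiplication by \<open>\<Sum> c\<^sub>i x\<^sub>i\<close> and zero.\<close>

fun (in module) koszul_d :: "'a list \<Rightarrow> (bool list \<Rightarrow> 'b) \<Rightarrow> bool list \<Rightarrow> 'b" where
  "koszul_d (x # xs) f (False # w) = koszul_d xs (\<lambda>v. f (False # v)) w"
| "koszul_d (x # xs) f (True # w) = x *s f (False # w) - koszul_d xs (\<lambda>v. f (True # v)) w"
| "koszul_d [] f w = 0"
| "koszul_d xs f [] = 0"

fun (in module) koszul_h :: "'a list \<Rightarrow> (bool list \<Rightarrow> 'b) \<Rightarrow> bool list \<Rightarrow> 'b" where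
  "koszul_h (c # cs) f (False # w) = c *s f (True # w) + koszul_h cs (\<lambda>v. f (False # v)) w"
| "koszul_h (c # cs) f (True # w) = - koszul_h cs (\<lambda>v. f (True # v)) w"
| "koszul_h [] f w = 0"
| "koszul_h cs f [] = 0"

definition (in module) fun_scale :: "'a \<Rightarrow> (bool list \<Rightarrow> 'b) \<Rightarrow> bool list \<Rightarrow> 'b" where
  "fun_scale c f = (\<lambda>w. c *s f w)"

definition (in module) koszul_exact :: "'a list \<Rightarrow> 'b set \<Rightarrow> 'b set \<Rightarrow> nat \<Rightarrow> bool" where
  "koszul_exact xs N L k \<longleftrightarrow>
     cochains (length xs) (Suc k) N \<inter> koszul_d xs -` cochains (length xs) (Suc (Suc k)) L
     \<subseteq> msum fun_scale (koszul_d xs ` cochains (length xs) k N) (cochains (length xs) (Suc k) L)"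

definition (in module) nonzerodivisor :: "'b set \<Rightarrow> 'b set \<Rightarrow> 'a \<Rightarrow> bool" where
  "nonzerodivisor N L y \<longleftrightarrow> (\<forall>z\<in>N. y *s z \<in> L \<longrightarrow> z \<in> L)"

lemma Cons_mem_words [simp]:
  "False # w \<in> words (Suc r) k \<longleftrightarrow> w \<in> words r k"
  "True # w \<in> words (Suc r) (Suc k) \<longleftrightarrow> w \<in> words r k"
  by (auto simp: words_def)

lemma finite_words: "finite (words r k)"
  using finite_lists_length_eq[of "UNIV :: bool set" r]
  by (rule finite_subset[rotated]) (auto simp: words_def)

lemma cochains_iff:
  "0 \<in> N \<Longrightarrow> f \<in> cochains r k N \<longleftrightarrow> (\<forall>w. f w \<in> N) \<and> (\<forall>w. w \<notin> words r k \<longrightarrow> f w = 0)"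
  by (auto simp: cochains_def)

lemma cochains_outside: "f \<in> cochains r k N \<Longrightarrow> w \<notin> words r k \<Longrightarrow> f w = 0"
  by (simp add: cochains_def)

lemma cochains_value: "f \<in> cochains r k N \<Longrightarrow> 0 \<in> N \<Longrightarrow> f w \<in> N"
  using cochains_iff by blast

lemma cochains_mono: "N \<subseteq> N' \<Longrightarrow> cochains r k N \<subseteq> cochains r k N'"
  by (auto simp: cochains_def)

lemma cochains_change_values: "f \<in> cochains r k N \<Longrightarrow> (\<And>w. f w \<in> L) \<Longrightarrow> f \<in> cochains r k L"
  by (auto simp: cochains_def)

lemma cochains_0: "cochains r 0 N = {0}"
  by (auto simp: cochains_def words_def)

lemma cochains_above_length:
  assumes "Suc r < k"
  shows "cochains r k N = {0}"
proof -
  have "w \<notin> words r k" for w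
    using assms count_le_length[of w True] by (auto simp: words_def)
  then show ?thesis by (auto simp: cochains_def)
qed

lemma single_cochain: "w \<in> words r k \<Longrightarrow> 0 \<in> N \<Longrightarrow> z \<in> N \<Longrightarrow> single w z \<in> cochains r k N"
  by (auto simp: cochains_def single_def)

lemma bool_list_cases [case_names Nil False True]:
  assumes "w = [] \<Longrightarrow> P" "\<And>v. w = False # v \<Longrightarrow> P" "\<And>v. w = True # v \<Longrightarrow> P"
  shows P
  using assms by (metis (full_types) neq_Nil_conv)

lemma cochains_Cons_iff:
  "f \<in> cochains (Suc r) (Suc k) N \<longleftrightarrow>
    f [] = 0 \<and> (\<lambda>w. f (False # w)) \<in> cochains r (Suc k) N \<and> (\<lambda>w. f (True # w)) \<in> cochains r k N"
  (is "_ \<longleftrightarrow> ?r")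
proof
  assume "f \<in> cochains (Suc r) (Suc k) N"
  then show ?r by (simp add: cochains_def) (simp add: words_def)
next
  assume parts: ?r
  have "(w \<in> words (Suc r) (Suc k) \<longrightarrow> f w \<in> N) \<and> (w \<notin> words (Suc r) (Suc k) \<longrightarrow> f w = 0)" for w
  proof (cases w rule: bool_list_cases)
    case Nil
    with parts show ?thesis by (simp add: words_def)
  qed (use parts in \<open>simp_all add: cochains_def\<close>)
  then show "f \<in> cochains (Suc r) (Suc k) N" by (simp add: cochains_def)
qed

lemma mem_span_set_list:
  assumes "y \<in> ring.span (set xs)"
  obtains cs where "length cs = length xs" "y = (\<Sum>(c, x)\<leftarrow>zip cs xs. c * x)"
proof -
  from assms have "\<exists>cs. length cs = length xs \<and> y = (\<Sum>(c, x)\<leftarrow>zip cs xs. c * x)"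
  proof (induction xs arbitrary: y)
    case (Cons a xs)
    then obtain k where "y - k * a \<in> ring.span (set xs)"
      by (auto simp: ring.span_insert)
    then obtain cs where "length cs = length xs" "y - k * a = (\<Sum>(c, x)\<leftarrow>zip cs xs. c * x)"
      using Cons.IH by blast
    then show ?case by (intro exI[of _ "k # cs"]) (simp add: algebra_simps)
  qed simp
  with that show ?thesis by blast
qed

context module
begin

interpretation fn: module fun_scale
  by standard (auto simp: fun_scale_def fun_eq_iff algebra_simps)

lemma fun_scale_apply [simp]: "fun_scale c f w = c *s f w"
  by (simp add: fun_scale_def)

interpretation d: module_hom fun_scale fun_scale "koszul_d xs" for xs
proof unfold_locales
  have add: "koszul_d xs (\<lambda>v. f v + g v) w = koszul_d xs f w + koszul_d xs g w" for f g w
  proof (induction xs arbitrary: f g w)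
    case (Cons x xs)
    then show ?case by (cases w rule: bool_list_cases) (simp_all add: scale_right_distrib)
  qed simp
  then show "koszul_d xs (f + g) = koszul_d xs f + koszul_d xs g" for f g
    by (simp add: fun_eq_iff plus_fun_def)
  have scale: "koszul_d xs (\<lambda>v. c *s f v) w = c *s koszul_d xs f w" for c f w
  proof (induction xs arbitrary: f w)
    case (Cons x xs)
    then show ?case
      by (cases w rule: bool_list_cases) (simp_all add: scale_right_diff_distrib mult.commute)
  qed simp
  then show "koszul_d xs (fun_scale c f) = fun_scale c (koszul_d xs f)" for c f
    by (simp add: fun_eq_iff fun_scale_def)
qed

interpretation h: module_hom fun_scale fun_scale "koszul_h cs" for cs
proof unfold_locales
  have add: "koszul_h cs (\<lambda>v. f v + g v) w = koszul_h cs f w + koszul_h cs g w" for f g w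
  proof (induction cs arbitrary: f g w)
    case (Cons c cs)
    then show ?case by (cases w rule: bool_list_cases) (simp_all add: scale_right_distrib)
  qed simp
  then show "koszul_h cs (f + g) = koszul_h cs f + koszul_h cs g" for f g
    by (simp add: fun_eq_iff plus_fun_def)
  have scale: "koszul_h cs (\<lambda>v. b *s f v) w = b *s koszul_h cs f w" for b f w
  proof (induction cs arbitrary: f w)
    case (Cons c cs)
    then show ?case
      by (cases w rule: bool_list_cases) (simp_all add: scale_right_distrib mult.commute)
  qed simp
  then show "koszul_h cs (fun_scale b f) = fun_scale b (koszul_h cs f)" for b f
    by (simp add: fun_eq_iff fun_scale_def)
qed

lemma module_hom_single: "module_hom scale fun_scale (single w)"
  by unfold_locales (auto simp: single_def fun_eq_iff)

lemma subspace_cochains: "subspace N \<Longrightarrow> fn.subspace (cochains r k N)"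
  by (rule fn.subspaceI) (auto simp: cochains_def subspace_0 subspace_add subspace_scale)

lemma koszul_d_pointwise:
  "koszul_d xs (\<lambda>v. f v - g v) w = koszul_d xs f w - koszul_d xs g w"
  "koszul_d xs (\<lambda>v. f v + g v) w = koszul_d xs f w + koszul_d xs g w"
  "koszul_d xs (\<lambda>v. - f v) w = - koszul_d xs f w"
  "koszul_d xs (\<lambda>v. c *s f v) w = c *s koszul_d xs f w"
  "koszul_d xs (\<lambda>v. 0) w = 0"
  using d.diff[of xs f g] d.add[of xs f g] d.neg[of xs f] d.scale[of xs c f] d.zero[of xs]
  by (simp_all add: fun_eq_iff fun_diff_def plus_fun_def fun_Compl_def fun_scale_def zero_fun_def)

lemma koszul_h_pointwise:
  "koszul_h cs (\<lambda>v. f v - g v) w = koszul_h cs f w - koszul_h cs g w"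
  "koszul_h cs (\<lambda>v. c *s f v) w = c *s koszul_h cs f w"
  "koszul_h cs (\<lambda>v. 0) w = 0"
  using h.diff[of cs f g] h.scale[of cs c f] h.zero[of cs]
  by (simp_all add: fun_eq_iff fun_diff_def fun_scale_def zero_fun_def)

lemma koszul_d_d: "koszul_d xs (koszul_d xs f) = 0"
proof -
  have "koszul_d xs (koszul_d xs f) w = 0" for w
  proof (induction xs arbitrary: f w)
    case (Cons x xs)
    then show ?case
      by (cases w rule: bool_list_cases) (simp_all add: koszul_d_pointwise)
  qed simp
  then show ?thesis by (simp add: fun_eq_iff)
qed

lemma koszul_d_cochains:
  assumes "subspace N"
  shows "f \<in> cochains (length xs) k N \<Longrightarrow> koszul_d xs f \<in> cochains (length xs) (Suc k) N"
proof (induction xs arbitrary: f k)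
  case Nil
  then show ?case using subspace_0[OF assms] by (simp add: cochains_def)
next
  case (Cons x xs)
  show ?case
  proof (cases k)
    case 0
    with Cons.prems have "f = 0" by (simp add: cochains_0)
    then show ?thesis using fn.subspace_0[OF subspace_cochains[OF assms]] by (simp only: d.zero)
  next
    case (Suc j)
    with Cons.prems have False_part: "(\<lambda>w. f (False # w)) \<in> cochains (length xs) k N"
      and True_part: "(\<lambda>w. f (True # w)) \<in> cochains (length xs) j N"
      by (simp_all add: cochains_Cons_iff)
    have "fun_scale x (\<lambda>w. f (False # w)) - koszul_d xs (\<lambda>w. f (True # w))
        \<in> cochains (length xs) k N"
      using False_part True_part Cons.IH[OF True_part] Suc
      by (intro fn.subspace_diff fn.subspace_scale subspace_cochains assms) auto
    with Cons.IH[OF False_part] show ?thesis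
      by (simp add: cochains_Cons_iff Suc fun_diff_def)
  qed
qed

lemma koszul_h_cochains:
  assumes "subspace N"
  shows "f \<in> cochains (length cs) (Suc k) N \<Longrightarrow> koszul_h cs f \<in> cochains (length cs) k N"
proof (induction cs arbitrary: f k)
  case Nil
  then show ?case using subspace_0[OF assms] by (simp add: cochains_def)
next
  case (Cons c cs)
  then have False_part: "(\<lambda>w. f (False # w)) \<in> cochains (length cs) (Suc k) N"
      and True_part: "(\<lambda>w. f (True # w)) \<in> cochains (length cs) k N"
    by (simp_all add: cochains_Cons_iff)
  show ?case
  proof (cases k)
    case 0
    have "koszul_h (c # cs) f w = 0" for w
      using Cons.IH[OF False_part] True_part
      by (cases w rule: bool_list_cases) (simp_all add: 0 cochains_0 fun_eq_iff koszul_h_pointwise)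
    then show ?thesis by (simp add: 0 cochains_0 fun_eq_iff)
  next
    case (Suc j)
    have "fun_scale c (\<lambda>w. f (True # w)) + koszul_h cs (\<lambda>w. f (False # w))
        \<in> cochains (length cs) k N"
      using True_part Cons.IH[OF False_part]
      by (intro fn.subspace_add fn.subspace_scale subspace_cochains assms)
    moreover have "- koszul_h cs (\<lambda>w. f (True # w)) \<in> cochains (length cs) j N"
      using Cons.IH[of _ j] True_part Suc by (intro fn.subspace_neg subspace_cochains assms) auto
    ultimately show ?thesis
      by (simp add: cochains_Cons_iff Suc plus_fun_def fun_Compl_def)
  qed
qed

lemma koszul_homotopy_apply:
  "length cs = length xs \<Longrightarrow> length w = length xs \<Longrightarrow>
    koszul_d xs (koszul_h cs f) w + koszul_h cs (koszul_d xs f) w =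
    (\<Sum>(c, x)\<leftarrow>zip cs xs. c * x) *s f w"
proof (induction xs arbitrary: cs f w)
  case (Cons x xs)
  obtain c ds where cs_eq: "cs = c # ds" using Cons.prems by (cases cs) auto
  with Cons.prems have length_ds: "length ds = length xs" by simp
  show ?case
  proof (cases w rule: bool_list_cases)
    case Nil
    then show ?thesis using Cons.prems by simp
  next
    case (False v)
    with Cons.IH[OF length_ds, of v "\<lambda>v. f (False # v)"] Cons.prems show ?thesis
      by (simp add: cs_eq koszul_d_pointwise algebra_simps)
  next
    case (True v)
    with Cons.IH[OF length_ds, of v "\<lambda>v. f (True # v)"] Cons.prems show ?thesis
      by (simp add: cs_eq koszul_d_pointwise koszul_h_pointwise algebra_simps)
  qed
qed simp

lemma koszul_d_h_cochains:
  assumes subspace_N: "subspace N" and f_mem: "f \<in> cochains (length xs) k N"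
    and "length cs = length xs"
  shows "koszul_d xs (koszul_h cs f) \<in> cochains (length xs) k N"
proof (cases k)
  case 0
  then show ?thesis using f_mem by (simp add: cochains_0)
next
  case (Suc j)
  then have "koszul_h cs f \<in> cochains (length xs) j N"
    using koszul_h_cochains[OF subspace_N, of f cs j] f_mem assms(3) by simp
  then show ?thesis using koszul_d_cochains[OF subspace_N] Suc by simp
qed

lemma koszul_h_d_cochains:
  assumes "subspace N" "f \<in> cochains (length xs) k N" "length cs = length xs"
  shows "koszul_h cs (koszul_d xs f) \<in> cochains (length xs) k N"
  using koszul_h_cochains[OF assms(1), of "koszul_d xs f" cs] koszul_d_cochains[OF assms(1,2)]
    assms(3) by simp

lemma koszul_homotopy:
  assumes "y \<in> ring.span (set xs)"
  obtains cs where "length cs = length xs"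
    "\<And>f k N. subspace N \<Longrightarrow> f \<in> cochains (length xs) k N \<Longrightarrow>
      koszul_d xs (koszul_h cs f) + koszul_h cs (koszul_d xs f) = fun_scale y f"
proof -
  obtain cs where length_cs: "length cs = length xs" and y_eq: "y = (\<Sum>(c, x)\<leftarrow>zip cs xs. c * x)"
    using assms by (rule mem_span_set_list)
  have "koszul_d xs (koszul_h cs f) w + koszul_h cs (koszul_d xs f) w = y *s f w"
    if subspace_N: "subspace N" and f_mem: "f \<in> cochains (length xs) k N" for f k N w
  proof (cases "length w = length xs")
    case True
    then show ?thesis using koszul_homotopy_apply[OF length_cs] y_eq by simp
  next
    case False
    then have "w \<notin> words (length xs) k" by (simp add: words_def)
    then show ?thesis
      using cochains_outside[OF f_mem] cochains_outside[OF koszul_d_h_cochains[OF that length_cs]]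
        cochains_outside[OF koszul_h_d_cochains[OF that length_cs]] by simp
  qed
  then have "koszul_d xs (koszul_h cs f) + koszul_h cs (koszul_d xs f) = fun_scale y f"
    if "subspace N" "f \<in> cochains (length xs) k N" for f k N
    using that by (simp add: fun_eq_iff)
  with length_cs show ?thesis by (rule that)
qed

lemma koszul_d_value:
  assumes "\<And>w. f w \<in> N"
  shows "koszul_d xs f w \<in> set xs \<odot> N"
  using assms
proof (induction xs arbitrary: f w)
  case Nil
  then show ?case by (simp add: subspace_0 subspace_smod)
next
  case (Cons x xs)
  have "koszul_d xs g v \<in> set (x # xs) \<odot> N" if "\<And>w. g w \<in> N" for g v
    using Cons.IH[of g v] that smod_mono[of "set xs" "set (x # xs)" N N] by auto
  moreover have "x *s f v \<in> set (x # xs) \<odot> N" for v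
    using Cons.prems by (intro smodI) auto
  ultimately show ?case
    using Cons.prems by (cases w rule: bool_list_cases)
      (auto simp: subspace_0 subspace_smod intro!: subspace_diff)
qed

lemma koszul_d_single_value:
  assumes "subspace L" "\<forall>x\<in>set xs. x *s z \<in> L"
  shows "koszul_d xs (single (replicate (length xs) False) z) w \<in> L"
  using assms(2)
proof (induction xs arbitrary: w)
  case Nil
  then show ?case using assms(1) by (simp add: subspace_0)
next
  case (Cons a xs)
  then show ?case using assms(1)
    by (cases w rule: bool_list_cases) (auto simp: single_def subspace_0 koszul_d_pointwise)
qed

lemma cochains_least:
  assumes subspace_S: "fn.subspace S"
    and single_mem: "\<And>w z. w \<in> words r k \<Longrightarrow> z \<in> N \<Longrightarrow> single w z \<in> S"
  shows "cochains r k N \<subseteq> S"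
proof
  fix f assume f_mem: "f \<in> cochains r k N"
  have sum_apply: "(\<Sum>w\<in>A. g w) v = (\<Sum>w\<in>A. g w v)" for g :: "bool list \<Rightarrow> bool list \<Rightarrow> 'b" and A v
    by (induction A rule: infinite_finite_induct) auto
  have "f = (\<Sum>w\<in>words r k. single w (f w))"
    using f_mem finite_words by (auto simp: fun_eq_iff sum_apply single_def cochains_outside)
  also have "\<dots> \<in> S"
    using f_mem by (intro fn.subspace_sum[OF subspace_S] single_mem) (auto simp: cochains_def)
  finally show "f \<in> S" .
qed

lemma cochains_msum_smod:
  assumes subspace_U: "subspace U" and subspace_N: "subspace N"
  shows "cochains r k (U \<oplus> A \<odot> N) =
      msum fun_scale (cochains r k U) (smod fun_scale A (cochains r k N))"
    (is "_ = ?S")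
proof (rule equalityI)
  show "cochains r k (U \<oplus> A \<odot> N) \<subseteq> ?S"
  proof (rule cochains_least[OF fn.subspace_msum])
    fix w z assume w_mem: "w \<in> words r k" and z_mem: "z \<in> U \<oplus> A \<odot> N"
    interpret s: module_hom scale fun_scale "single w" by (rule module_hom_single)
    have "U \<subseteq> single w -` ?S"
      using single_cochain[OF w_mem subspace_0[OF subspace_U]] fn.msum_upper1 by blast
    moreover have "A \<odot> N \<subseteq> single w -` ?S"
    proof (intro smod_least s.subspace_vimage fn.subspace_msum)
      fix a x assume "a \<in> A" "x \<in> N"
      then have "fun_scale a (single w x) \<in> smod fun_scale A (cochains r k N)"
        using single_cochain[OF w_mem subspace_0[OF subspace_N]] by (intro fn.smodI)
      then show "a *s x \<in> single w -` ?S"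
        using fn.msum_upper2 by (auto simp: s.scale)
    qed
    ultimately have "U \<oplus> A \<odot> N \<subseteq> single w -` ?S"
      by (intro msum_least s.subspace_vimage fn.subspace_msum)
    with z_mem show "single w z \<in> ?S" by blast
  qed
  have "fun_scale a f \<in> cochains r k (U \<oplus> A \<odot> N)" if "a \<in> A" "f \<in> cochains r k N" for a f
    using that smodI msum_upper2[of "A \<odot> N" U] by (auto simp: cochains_def)
  then have "smod fun_scale A (cochains r k N) \<subseteq> cochains r k (U \<oplus> A \<odot> N)"
    by (intro fn.smod_least subspace_cochains subspace_msum)
  then show "?S \<subseteq> cochains r k (U \<oplus> A \<odot> N)"
    by (intro fn.msum_least subspace_cochains subspace_msum cochains_mono msum_upper1)
qed

lemma noetherian_cochains:
  assumes noetherian_R: "noetherian_ring TYPE('a)" and fin_gen_T: "fin_gen scale T"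
  shows "fn.noetherian (cochains r k T)"
proof -
  obtain G where finite_G: "finite G" and T_eq: "T = span G"
    using fin_gen_T unfolding fin_gen_def by blast
  let ?H = "\<Union>w\<in>words r k. single w ` G"
  have "fn.noetherian (fn.span ?H)"
    using finite_G finite_words by (intro fn.noetherian_span_finite[OF noetherian_R]) auto
  moreover have "cochains r k T \<subseteq> fn.span ?H"
  proof (intro cochains_least fn.subspace_span)
    fix w z assume w_mem: "w \<in> words r k" and z_mem: "z \<in> T"
    have "single w z \<in> fn.span (single w ` G)"
      using z_mem unfolding T_eq module_hom.span_image[OF module_hom_single] by blast
    then show "single w z \<in> fn.span ?H"
      using w_mem fn.span_mono[of "single w ` G" ?H] by blast
  qed
  ultimately show ?thesis by (rule fn.noetherian_subset)
qed

lemma koszul_exactI: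
  assumes "\<And>f. f \<in> cochains (length xs) (Suc k) N \<Longrightarrow>
      koszul_d xs f \<in> cochains (length xs) (Suc (Suc k)) L \<Longrightarrow>
      \<exists>g\<in>cochains (length xs) k N. f - koszul_d xs g \<in> cochains (length xs) (Suc k) L"
  shows "koszul_exact xs N L k"
  unfolding koszul_exact_def
proof
  let ?C = "cochains (length xs)"
  fix f assume "f \<in> ?C (Suc k) N \<inter> koszul_d xs -` ?C (Suc (Suc k)) L"
  then obtain g where "g \<in> ?C k N" "f - koszul_d xs g \<in> ?C (Suc k) L"
    using assms by blast
  then have "koszul_d xs g + (f - koszul_d xs g)
      \<in> msum fun_scale (koszul_d xs ` ?C k N) (?C (Suc k) L)"
    by (intro fn.msumI imageI)
  then show "f \<in> msum fun_scale (koszul_d xs ` ?C k N) (?C (Suc k) L)" by simp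
qed

lemma koszul_exactE:
  assumes exact: "koszul_exact xs N L k" and subspace_N: "subspace N" and subspace_L: "subspace L"
    and f_mem: "f \<in> cochains (length xs) (Suc k) N"
    and df_mem: "koszul_d xs f \<in> cochains (length xs) (Suc (Suc k)) L"
  obtains g where "g \<in> cochains (length xs) k N"
    and "f - koszul_d xs g \<in> cochains (length xs) (Suc k) L"
proof -
  let ?C = "cochains (length xs)"
  have "f \<in> msum fun_scale (koszul_d xs ` ?C k N) (?C (Suc k) L)"
    using exact f_mem df_mem unfolding koszul_exact_def by blast
  then obtain b l where "b \<in> koszul_d xs ` ?C k N" and l_mem: "l \<in> ?C (Suc k) L"
      and f_eq: "f = b + l"
    by (rule fn.msumE[OF _ d.subspace_image[OF subspace_cochains[OF subspace_N]]
          subspace_cochains[OF subspace_L]])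
  then obtain g where g_mem: "g \<in> ?C k N" and b_eq: "b = koszul_d xs g" by blast
  have "f - koszul_d xs g \<in> ?C (Suc k) L"
    using l_mem unfolding f_eq b_eq by simp
  with g_mem show ?thesis by (rule that)
qed

lemma nonzerodivisor_cochains:
  "nonzerodivisor N L y \<Longrightarrow> f \<in> cochains r k N \<Longrightarrow> fun_scale y f \<in> cochains r k L \<Longrightarrow> f \<in> cochains r k L"
  by (auto simp: nonzerodivisor_def cochains_def)

lemma cochains_quotientE:
  assumes subspace_N: "subspace N" and subspace_L: "subspace L"
    and f_mem: "f \<in> cochains r k (L \<oplus> {y} \<odot> N)"
  obtains l g where "l \<in> cochains r k L" "g \<in> cochains r k N" "f = l + fun_scale y g"
proof -
  have "f \<in> msum fun_scale (cochains r k L) (fun_scale y ` cochains r k N)"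
    using f_mem unfolding cochains_msum_smod[OF subspace_L subspace_N]
      fn.smod_singleton[OF subspace_cochains[OF subspace_N]] .
  then obtain l b where "l \<in> cochains r k L" "b \<in> fun_scale y ` cochains r k N" "f = l + b"
    by (rule fn.msumE[OF _ subspace_cochains[OF subspace_L]
          module_hom.subspace_image[OF fn.module_hom_scale_self subspace_cochains[OF subspace_N]]])
  then show ?thesis using that by blast
qed

lemma cochains_quotientI:
  assumes "subspace N" "subspace L" "l \<in> cochains r k L" "g \<in> cochains r k N"
  shows "l + fun_scale y g \<in> cochains r k (L \<oplus> {y} \<odot> N)"
  unfolding cochains_msum_smod[OF assms(2,1)] by (intro fn.msumI fn.smodI assms(3,4)) simp

lemma koszul_exact_quotientI:
  assumes subspace_N: "subspace N" and subspace_L: "subspace L"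
    and regular_y: "nonzerodivisor N L y"
    and exact_k: "koszul_exact xs N L k" and exact_Suc: "koszul_exact xs N L (Suc k)"
  shows "koszul_exact xs N (L \<oplus> {y} \<odot> N) k"
proof (rule koszul_exactI)
  let ?d = "koszul_d xs" and ?C = "cochains (length xs)" and ?L' = "L \<oplus> {y} \<odot> N"
  fix f assume f_mem: "f \<in> ?C (Suc k) N" and df_mem: "?d f \<in> ?C (Suc (Suc k)) ?L'"
  obtain l g where l_mem: "l \<in> ?C (Suc (Suc k)) L" and g_mem: "g \<in> ?C (Suc (Suc k)) N"
      and df_eq: "?d f = l + fun_scale y g"
    by (rule cochains_quotientE[OF subspace_N subspace_L df_mem])
  have "fun_scale y (?d g) = - ?d l"
    using koszul_d_d[of xs f] unfolding df_eq d.add d.scale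
    by (simp add: eq_neg_iff_add_eq_0 add.commute)
  also have "\<dots> \<in> ?C (Suc (Suc (Suc k))) L"
    by (intro fn.subspace_neg subspace_cochains koszul_d_cochains subspace_L l_mem)
  finally have "?d g \<in> ?C (Suc (Suc (Suc k))) L"
    by (rule nonzerodivisor_cochains[OF regular_y koszul_d_cochains[OF subspace_N g_mem]])
  then obtain h where h_mem: "h \<in> ?C (Suc k) N" and g_diff_mem: "g - ?d h \<in> ?C (Suc (Suc k)) L"
    by (rule koszul_exactE[OF exact_Suc subspace_N subspace_L g_mem])
  have "?d (f - fun_scale y h) = l + fun_scale y (g - ?d h)"
    by (simp add: df_eq d.diff d.scale fn.scale_right_diff_distrib)
  also have "\<dots> \<in> ?C (Suc (Suc k)) L"
    by (intro fn.subspace_add fn.subspace_scale subspace_cochains subspace_L l_mem h_mem g_diff_mem)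
  finally obtain e where e_mem: "e \<in> ?C k N"
      and f_diff_mem: "f - fun_scale y h - ?d e \<in> ?C (Suc k) L"
    using koszul_exactE[OF exact_k subspace_N subspace_L, of "f - fun_scale y h"] f_mem h_mem
      fn.subspace_diff[OF subspace_cochains[OF subspace_N]]
      fn.subspace_scale[OF subspace_cochains[OF subspace_N]] by metis
  have "(f - fun_scale y h - ?d e) + fun_scale y h \<in> ?C (Suc k) ?L'"
    by (rule cochains_quotientI[OF subspace_N subspace_L f_diff_mem h_mem])
  then have "f - ?d e \<in> ?C (Suc k) ?L'" by (simp add: algebra_simps)
  with e_mem show "\<exists>e\<in>?C k N. f - ?d e \<in> ?C (Suc k) ?L'" by blast
qed

lemma koszul_exact_quotientD:
  assumes subspace_N: "subspace N" and subspace_L: "subspace L"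
    and regular_y: "nonzerodivisor N L y" and y_span: "y \<in> ring.span (set xs)"
    and exact: "koszul_exact xs N (L \<oplus> {y} \<odot> N) k"
  shows "koszul_exact xs N L (Suc k)"
proof (rule koszul_exactI)
  let ?d = "koszul_d xs" and ?C = "cochains (length xs)" and ?L' = "L \<oplus> {y} \<odot> N"
  fix g assume g_mem: "g \<in> ?C (Suc (Suc k)) N" and dg_mem: "?d g \<in> ?C (Suc (Suc (Suc k))) L"
  obtain cs where length_cs: "length cs = length xs"
      and homotopy: "?d (koszul_h cs g) + koszul_h cs (?d g) = fun_scale y g"
    using koszul_homotopy[OF y_span] subspace_N g_mem by metis
  let ?f = "koszul_h cs g"
  have hg_mem: "?f \<in> ?C (Suc k) N" and hdg_mem: "- koszul_h cs (?d g) \<in> ?C (Suc (Suc k)) L"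
    using koszul_h_cochains[OF subspace_N, of g cs] koszul_h_cochains[OF subspace_L, of "?d g" cs]
      g_mem dg_mem length_cs
    by (simp_all add: fn.subspace_neg[OF subspace_cochains[OF subspace_L]])
  have dhg_eq: "?d ?f = - koszul_h cs (?d g) + fun_scale y g"
    unfolding homotopy[symmetric] by simp
  then have "?d ?f \<in> ?C (Suc (Suc k)) ?L'"
    using cochains_quotientI[OF subspace_N subspace_L hdg_mem g_mem] by simp
  then obtain e where "e \<in> ?C k N" and hg_diff_mem: "?f - ?d e \<in> ?C (Suc k) ?L'"
    by (rule koszul_exactE[OF exact subspace_N subspace_msum hg_mem])
  obtain l m where l_mem: "l \<in> ?C (Suc k) L" and m_mem: "m \<in> ?C (Suc k) N"
      and hg_diff_eq: "?f - ?d e = l + fun_scale y m"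
    by (rule cochains_quotientE[OF subspace_N subspace_L hg_diff_mem])
  have "?d ?f = ?d l + fun_scale y (?d m)"
    using arg_cong[OF hg_diff_eq, of ?d] by (simp add: d.diff d.add d.scale koszul_d_d)
  then have "fun_scale y (g - ?d m) = ?d l - (- koszul_h cs (?d g))"
    using dhg_eq by (simp add: fn.scale_right_diff_distrib algebra_simps)
  also have "\<dots> \<in> ?C (Suc (Suc k)) L"
    by (intro fn.subspace_diff subspace_cochains koszul_d_cochains subspace_L l_mem hdg_mem)
  finally have "g - ?d m \<in> ?C (Suc (Suc k)) L"
    by (rule nonzerodivisor_cochains[OF regular_y
          fn.subspace_diff[OF subspace_cochains[OF subspace_N] g_mem
            koszul_d_cochains[OF subspace_N m_mem]]])
  with m_mem show "\<exists>m\<in>?C (Suc k) N. g - ?d m \<in> ?C (Suc (Suc k)) L" by blast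
qed

lemma koszul_exact_0I:
  assumes subspace_N: "subspace N" and subspace_L: "subspace L"
    and regular_y: "nonzerodivisor N L y" and y_span: "y \<in> ring.span (set xs)"
  shows "koszul_exact xs N L 0"
proof (rule koszul_exactI)
  let ?d = "koszul_d xs" and ?C = "cochains (length xs)"
  fix f assume f_mem: "f \<in> ?C (Suc 0) N" and df_mem: "?d f \<in> ?C (Suc (Suc 0)) L"
  obtain cs where length_cs: "length cs = length xs"
      and homotopy: "?d (koszul_h cs f) + koszul_h cs (?d f) = fun_scale y f"
    using koszul_homotopy[OF y_span] subspace_N f_mem by metis
  have "koszul_h cs f = 0"
    using koszul_h_cochains[OF subspace_N, of f cs 0] f_mem length_cs by (simp add: cochains_0)
  then have "fun_scale y f \<in> ?C (Suc 0) L"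
    using koszul_h_cochains[OF subspace_L, of "?d f" cs] df_mem length_cs homotopy by simp
  then have "f \<in> ?C (Suc 0) L"
    by (rule nonzerodivisor_cochains[OF regular_y f_mem])
  then show "\<exists>g\<in>?C 0 N. f - ?d g \<in> ?C (Suc 0) L" by (simp add: cochains_0)
qed

lemma koszul_exact_quotient_iff:
  assumes "subspace N" "subspace L" "nonzerodivisor N L y" "y \<in> ring.span (set xs)"
  shows "(\<forall>k<t. koszul_exact xs N (L \<oplus> {y} \<odot> N) k) \<longleftrightarrow> (\<forall>k<Suc t. koszul_exact xs N L k)"
  using koszul_exact_quotientI[OF assms(1-3)] koszul_exact_quotientD[OF assms]
    koszul_exact_0I[OF assms]
  by (metis Suc_less_eq less_Suc_eq_0_disj less_SucI)

lemma koszul_exact_0D: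
  assumes subspace_N: "subspace N" and subspace_L: "subspace L" and exact: "koszul_exact xs N L 0"
    and z_mem: "z \<in> N" and z_annihilated: "\<forall>x\<in>set xs. x *s z \<in> L"
  shows "z \<in> L"
proof -
  let ?w = "replicate (length xs) False"
  have "?w \<in> words (length xs) (Suc 0)" by (simp add: words_def count_list_0_iff)
  then have f_mem: "single ?w z \<in> cochains (length xs) (Suc 0) N"
    by (rule single_cochain[OF _ subspace_0[OF subspace_N] z_mem])
  have "koszul_d xs (single ?w z) \<in> cochains (length xs) (Suc (Suc 0)) L"
    by (rule cochains_change_values[OF koszul_d_cochains[OF subspace_N f_mem]
          koszul_d_single_value[OF subspace_L z_annihilated]])
  then obtain g where "g \<in> cochains (length xs) 0 N"
      "single ?w z - koszul_d xs g \<in> cochains (length xs) (Suc 0) L"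
    by (rule koszul_exactE[OF exact subspace_N subspace_L f_mem])
  then have "single ?w z ?w \<in> L"
    by (intro cochains_value[OF _ subspace_0[OF subspace_L]]) (simp add: cochains_0)
  then show ?thesis by (simp add: single_def)
qed

lemma koszul_exact_length:
  assumes subspace_N: "subspace N" and subspace_L: "subspace L"
    and exact: "koszul_exact xs N L (length xs)"
  shows "N \<subseteq> L \<oplus> set xs \<odot> N"
proof
  fix z assume z_mem: "z \<in> N"
  let ?w = "replicate (length xs) True"
  have "count_list (replicate n True) True = n" for n by (induction n) simp_all
  then have "?w \<in> words (length xs) (Suc (length xs))" by (simp add: words_def)
  then have f_mem: "single ?w z \<in> cochains (length xs) (Suc (length xs)) N"
    by (rule single_cochain[OF _ subspace_0[OF subspace_N] z_mem])
  have "koszul_d xs (single ?w z) \<in> cochains (length xs) (Suc (Suc (length xs))) L"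
    using koszul_d_cochains[OF subspace_N f_mem] by (simp add: cochains_above_length)
  then obtain g where g_mem: "g \<in> cochains (length xs) (length xs) N"
      and diff_mem: "single ?w z - koszul_d xs g \<in> cochains (length xs) (Suc (length xs)) L"
    by (rule koszul_exactE[OF exact subspace_N subspace_L f_mem])
  have "single ?w z ?w - koszul_d xs g ?w \<in> L"
    using cochains_value[OF diff_mem subspace_0[OF subspace_L], of ?w] by simp
  moreover have "koszul_d xs g ?w \<in> set xs \<odot> N"
    using cochains_value[OF g_mem subspace_0[OF subspace_N]] by (rule koszul_d_value)
  ultimately have "(single ?w z ?w - koszul_d xs g ?w) + koszul_d xs g ?w \<in> L \<oplus> set xs \<odot> N"
    by (rule msumI)
  then show "z \<in> L \<oplus> set xs \<odot> N" by (simp add: single_def)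
qed

lemma stable_family_cochains:
  assumes "stable_family A U N"
  shows "fn.stable_family A (cochains r k U) (\<lambda>n. cochains r k (N n))"
proof -
  note subspace_U = stable_family_base[OF assms] and rees_N = stable_family_rees[OF assms]
  have "fn.rees_family A (\<lambda>n. cochains r k (N n))"
    using rees_family_scale[OF rees_N]
    by (intro fn.rees_familyI subspace_cochains rees_family_subspace[OF rees_N])
      (auto simp: cochains_def)
  moreover have "fn.eventually_generated A (\<lambda>n. cochains r k U) (\<lambda>n. cochains r k (N n))"
    using stable_family_generated[OF assms]
    unfolding eventually_generated_def fn.eventually_generated_def
  proof eventually_elim
    case (elim n)
    then show ?case
      unfolding cochains_msum_smod[OF subspace_U rees_family_subspace[OF rees_N], symmetric]
      by (rule cochains_mono)
  qed
  ultimately show ?thesis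
    using subspace_U stable_family_base_subset[OF assms]
    by (simp add: fn.stable_family_def subspace_cochains cochains_mono)
qed

lemma eventually_const_koszul_exact:
  assumes noetherian_R: "noetherian_ring TYPE('a)" and ideal_I: "ideal I"
    and fin_gen_T: "fin_gen scale T"
    and stable_N: "stable_family I U N" and antimono_N: "antimono N" and N_subset: "\<And>n. N n \<subseteq> T"
    and stable_L: "stable_family I {0} L" and antimono_L: "antimono L" and L_subset: "\<And>n. L n \<subseteq> T"
  shows "eventually_const (\<lambda>n. koszul_exact xs (N n) (L n) k)"
proof -
  have cochains_zero: "cochains r j {0} = {0}" for r j
    by (auto simp: cochains_def fun_eq_iff) metis
  have noetherian: "fn.noetherian (cochains r j X)" if "X \<subseteq> T" for r j X
    using noetherian_cochains[OF noetherian_R fin_gen_T] cochains_mono[OF that]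
    by (rule fn.noetherian_subset)
  have rees: "fn.rees_family I (\<lambda>n. cochains r j (S n))" if "stable_family I V S" for r j V S
    using fn.stable_family_rees[OF stable_family_cochains[OF that]] .
  have "fn.rees_family I (\<lambda>n. msum fun_scale (koszul_d xs ` cochains (length xs) k (N n))
      (cochains (length xs) (Suc k) (L n)))"
    by (intro fn.rees_family_msum d.rees_family_image rees[OF stable_N] rees[OF stable_L])
  moreover have "antimono (\<lambda>n. msum fun_scale (koszul_d xs ` cochains (length xs) k (N n))
      (cochains (length xs) (Suc k) (L n)))"
    by (intro antimonoI fn.msum_mono image_mono cochains_mono antimonoD[OF antimono_N]
        antimonoD[OF antimono_L])
  ultimately show ?thesis
    unfolding koszul_exact_def
    using stable_family_cochains[OF stable_L, of "length xs" "Suc (Suc k)"]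
    by (intro d.eventually_const_cocycles_subset[OF noetherian_R ideal_I
          stable_family_cochains[OF stable_N]] noetherian N_subset L_subset)
      (simp_all add: cochains_zero)
qed

end

section \<open>Depth\<close>

context module
begin

lemma msum_smod_Un: "L \<oplus> (A \<union> B) \<odot> N = (L \<oplus> A \<odot> N) \<oplus> B \<odot> N"
  by (simp add: smod_Un msum_assoc)

lemma regular_seq_Nil: "regular_seq scale J N L [] \<longleftrightarrow> \<not> N \<subseteq> L \<oplus> {} \<odot> N"
  by (simp add: regular_seq_def)

lemma regular_seq_snoc:
  "regular_seq scale J N L (xs @ [y]) \<longleftrightarrow> regular_seq scale J N L xs \<and> y \<in> J \<and>
    nonzerodivisor N (L \<oplus> set xs \<odot> N) y \<and> \<not> N \<subseteq> L \<oplus> (set xs \<union> {y}) \<odot> N"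
proof -
  have "L \<oplus> set xs \<odot> N \<subseteq> L \<oplus> (set xs \<union> {y}) \<odot> N"
    by (intro msum_mono smod_mono) auto
  then show ?thesis
    unfolding regular_seq_def nonzerodivisor_def
    by (simp add: less_Suc_eq nth_append all_conj_distrib imp_conjR ball_conj_distrib) blast
qed

lemma koszul_exact_regular_seq_iff:
  assumes subspace_N: "subspace N" and subspace_L: "subspace L"
    and "regular_seq scale (ring.span (set gs)) N L xs"
  shows "(\<forall>k<t. koszul_exact gs N (L \<oplus> set xs \<odot> N) k) \<longleftrightarrow> (\<forall>k<t + length xs. koszul_exact gs N L k)"
  using assms(3)
proof (induction xs arbitrary: t rule: rev_induct)
  case Nil
  then show ?case using msum_absorb1[OF subspace_L, of "{0}"] subspace_0[OF subspace_L]
    by (simp add: smod_empty)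
next
  case (snoc y xs)
  then have regular_xs: "regular_seq scale (ring.span (set gs)) N L xs"
      and y_span: "y \<in> ring.span (set gs)"
      and regular_y: "nonzerodivisor N (L \<oplus> set xs \<odot> N) y"
    unfolding regular_seq_snoc by blast+
  have "L \<oplus> set (xs @ [y]) \<odot> N = (L \<oplus> set xs \<odot> N) \<oplus> {y} \<odot> N"
    using msum_smod_Un[of L "set xs" "{y}" N] by simp
  then have "(\<forall>k<t. koszul_exact gs N (L \<oplus> set (xs @ [y]) \<odot> N) k) \<longleftrightarrow>
      (\<forall>k<Suc t. koszul_exact gs N (L \<oplus> set xs \<odot> N) k)"
    using koszul_exact_quotient_iff[OF subspace_N subspace_msum regular_y y_span] by simp
  then show ?case using snoc.IH[OF regular_xs, of "Suc t"] by simp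
qed

lemma maximal_regular_seq_koszul:
  assumes noetherian_R: "noetherian_ring TYPE('a)" and J_eq: "J = ring.span (set gs)"
    and subspace_N: "subspace N" and noetherian_N: "noetherian N" and subspace_L: "subspace L"
    and proper: "\<not> N \<subseteq> L \<oplus> J \<odot> N"
    and maximal: "maximal_regular_seq scale J N L xs"
  shows "\<forall>k<length xs. koszul_exact gs N L k" and "\<not> koszul_exact gs N L (length xs)"
proof -
  let ?L = "L \<oplus> set xs \<odot> N"
  have regular_xs: "regular_seq scale J N L xs"
      and not_regular_snoc: "\<And>y. y \<in> J \<Longrightarrow> \<not> regular_seq scale J N L (xs @ [y])"
    using maximal unfolding maximal_regular_seq_def by blast+
  note exact_iff = koszul_exact_regular_seq_iff[OF subspace_N subspace_L regular_xs[unfolded J_eq]]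
  show exact: "\<forall>k<length xs. koszul_exact gs N L k"
    using exact_iff[of 0] by simp
  have "ideal J" unfolding ideal_def J_eq by (rule ring.subspace_span)
  moreover have "\<exists>z\<in>N - ?L. y *s z \<in> ?L" if y_mem: "y \<in> J" for y
  proof -
    have "set xs \<union> {y} \<subseteq> J" using regular_xs y_mem unfolding regular_seq_def by blast
    then have "\<not> N \<subseteq> L \<oplus> (set xs \<union> {y}) \<odot> N"
      using proper msum_mono[OF order_refl smod_mono[OF _ order_refl]] by blast
    then show ?thesis
      using regular_xs not_regular_snoc y_mem unfolding regular_seq_snoc nonzerodivisor_def by blast
  qed
  ultimately obtain z where z_mem: "z \<in> N - ?L" and J_annihilates: "J \<subseteq> colon ?L z"
    using ideal_of_zero_divisors_annihilates[OF noetherian_R _ subspace_N noetherian_N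
        subspace_msum] by blast
  have "\<forall>x\<in>set gs. x *s z \<in> ?L"
    using J_annihilates ring.span_superset[of "set gs"] unfolding J_eq colon_def by blast
  then have "\<not> koszul_exact gs N ?L 0"
    using koszul_exact_0D[OF subspace_N subspace_msum] z_mem by blast
  then show "\<not> koszul_exact gs N L (length xs)"
    using exact_iff[of 1] exact by (auto simp: less_Suc_eq)
qed

lemma regular_seq_length_le:
  assumes subspace_N: "subspace N" and subspace_L: "subspace L"
    and proper: "\<not> N \<subseteq> L \<oplus> ring.span (set gs) \<odot> N"
    and regular_xs: "regular_seq scale (ring.span (set gs)) N L xs"
  shows "length xs \<le> length gs"
proof -
  have "\<not> koszul_exact gs N L (length gs)"
    using koszul_exact_length[OF subspace_N subspace_L] proper
    by (auto simp: smod_span[OF subspace_N])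
  then show ?thesis
    using koszul_exact_regular_seq_iff[OF subspace_N subspace_L regular_xs, of 0]
    by (auto intro: leI)
qed

lemma ex_maximal_regular_seq:
  assumes subspace_N: "subspace N" and subspace_L: "subspace L"
    and proper: "\<not> N \<subseteq> L \<oplus> ring.span (set gs) \<odot> N"
  shows "\<exists>xs. maximal_regular_seq scale (ring.span (set gs)) N L xs"
proof -
  let ?regular = "regular_seq scale (ring.span (set gs)) N L"
  have "L \<oplus> {} \<odot> N \<subseteq> L \<oplus> ring.span (set gs) \<odot> N"
    by (intro msum_mono smod_mono) auto
  then have "?regular []" using proper unfolding regular_seq_Nil by blast
  then obtain xs where "?regular xs" "\<And>ys. ?regular ys \<Longrightarrow> length ys \<le> length xs"
    using ex_has_greatest_nat[of ?regular "[]" length "Suc (length gs)"]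
      regular_seq_length_le[OF assms] le_imp_less_Suc by blast
  then have "maximal_regular_seq scale (ring.span (set gs)) N L xs"
    unfolding maximal_regular_seq_def
    by (metis impossible_Cons length_append_singleton not_less_eq_eq order_refl)
  then show ?thesis by blast
qed

theorem depth_eq_koszul:
  assumes noetherian_R: "noetherian_ring TYPE('a)" and J_eq: "J = ring.span (set gs)"
    and subspace_N: "subspace N" and noetherian_N: "noetherian N" and subspace_L: "subspace L"
    and proper: "\<not> N \<subseteq> L \<oplus> J \<odot> N"
  shows "depth scale J N L = Inf (enat ` {k \<in> {..length gs}. \<not> koszul_exact gs N L k})"
proof -
  let ?K = "{k \<in> {..length gs}. \<not> koszul_exact gs N L k}"
  note koszul = maximal_regular_seq_koszul[OF noetherian_R J_eq subspace_N noetherian_N subspace_L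
      proper]
  define d where "d = Inf (enat ` ?K)"
  have length_eq: "d = enat (length xs)" if maximal: "maximal_regular_seq scale J N L xs" for xs
    unfolding d_def
  proof (rule Inf_eqI)
    have "length xs \<le> length gs"
      using regular_seq_length_le[OF subspace_N subspace_L] proper maximal
      unfolding J_eq maximal_regular_seq_def by blast
    then show "y \<le> enat (length xs)" if "\<And>i. i \<in> enat ` ?K \<Longrightarrow> y \<le> i" for y
      using koszul(2)[OF maximal] that by auto
    show "enat (length xs) \<le> i" if "i \<in> enat ` ?K" for i
      using koszul(1)[OF maximal] that by (auto simp: not_less[symmetric])
  qed
  obtain xs where "maximal_regular_seq scale J N L xs"
    using ex_maximal_regular_seq[OF subspace_N subspace_L] proper J_eq by blast
  then have "{enat (length xs) |xs. maximal_regular_seq scale J N L xs} = {d}"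
    using length_eq by blast
  then show ?thesis unfolding depth_def d_def using proper by simp
qed

theorem eventually_const_depth:
  assumes noetherian_R: "noetherian_ring TYPE('a)" and ideal_I: "ideal I" and ideal_J: "ideal J"
    and fin_gen_T: "fin_gen scale T"
    and stable_N: "stable_family I U N" and antimono_N: "antimono N" and N_subset: "\<And>n. N n \<subseteq> T"
    and stable_L: "stable_family I {0} L" and antimono_L: "antimono L" and L_subset: "\<And>n. L n \<subseteq> T"
  shows "eventually_const (\<lambda>n. depth scale J (N n) (L n))"
proof -
  note rees_N = stable_family_rees[OF stable_N] and rees_L = stable_family_rees[OF stable_L]
  let ?improper = "\<lambda>n. N n \<subseteq> L n \<oplus> J \<odot> N n"
  obtain F where "finite F" "J = ring.span F"
    using noetherian_R ideal_J unfolding noetherian_ring_def by blast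
  then obtain gs where J_eq: "J = ring.span (set gs)"
    using finite_list by metis
  let ?K = "\<lambda>n. {k \<in> {..length gs}. \<not> koszul_exact gs (N n) (L n) k}"
  have "rees_family I (\<lambda>n. L n \<oplus> J \<odot> N n)"
    by (intro rees_family_msum rees_family_smod_const rees_N rees_L)
  moreover have "antimono (\<lambda>n. L n \<oplus> J \<odot> N n)"
    by (intro antimonoI msum_mono smod_mono order_refl antimonoD[OF antimono_N]
        antimonoD[OF antimono_L])
  ultimately have "eventually_const ?improper"
    by (rule eventually_const_stable_subset[OF stable_family_base_subset[OF stable_N]
          stable_family_generated[OF stable_N]])
  moreover have "eventually_const ?K"
    using eventually_const_koszul_exact[OF noetherian_R ideal_I fin_gen_T stable_N antimono_N
        N_subset stable_L antimono_L L_subset]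
    by (intro eventually_const_finite_Collect eventually_const_comp[of _ _ "\<lambda>p q. \<not> p"]) auto
  ultimately have "eventually_const (\<lambda>n. if ?improper n then \<infinity> else Inf (enat ` ?K n))"
    by (rule eventually_const_comp)
  moreover have "depth scale J (N n) (L n) = (if ?improper n then \<infinity> else Inf (enat ` ?K n))" for n
    using depth_eq_koszul[OF noetherian_R J_eq rees_family_subspace[OF rees_N] _
        rees_family_subspace[OF rees_L]]
      noetherian_subset[OF noetherian_fin_gen[OF noetherian_R fin_gen_T] N_subset]
    by (simp add: depth_def)
  ultimately show ?thesis by simp
qed

end

theorem theorem2p7:
  fixes scale :: "'a::comm_ring_1 \<Rightarrow> 'b::ab_group_add \<Rightarrow> 'b"
    and I J :: "'a set" and T U V W :: "'b set"
  assumes "module scale"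
    and "noetherian_ring TYPE('a)"
    and "ideal I" and "ideal J"
    and "module.subspace scale T" and "fin_gen scale T"
    and "module.subspace scale U" and "module.subspace scale V" and "module.subspace scale W"
    and "U \<subseteq> T" and "V \<subseteq> T" and "W \<subseteq> V"
  shows "\<exists>m. \<forall>n \<ge> m.
    depth scale J (msum scale U (smod scale (ideal_pow I n) V)) (smod scale (ideal_pow I n) W)
  = depth scale J (msum scale U (smod scale (ideal_pow I m) V)) (smod scale (ideal_pow I m) W)"
proof -
  interpret module scale by fact
  note subspace_V = assms(8) and subspace_W = assms(9)
  let ?N = "\<lambda>n. msum scale U (smod scale (ideal_pow I n) V)"
    and ?L = "\<lambda>n. smod scale (ideal_pow I n) W"
  have antimono_N: "antimono ?N"
    by (intro antimonoI msum_mono order_refl antimonoD[OF antimono_ideal_pow[OF subspace_V]])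
  have N_subset: "?N n \<subseteq> T" for n
    using smod_subset[OF subspace_V] \<open>V \<subseteq> T\<close> by (intro msum_least assms(5,10)) blast
  have L_subset: "?L n \<subseteq> T" for n
    using smod_subset[OF subspace_W] \<open>W \<subseteq> V\<close> \<open>V \<subseteq> T\<close> by blast
  have "eventually_const (\<lambda>n. depth scale J (?N n) (?L n))"
    by (rule eventually_const_depth[OF assms(2-4) \<open>fin_gen scale T\<close>
          stable_family_msum_ideal_pow[OF assms(7) subspace_V] antimono_N N_subset
          stable_family_ideal_pow[OF subspace_W] antimono_ideal_pow[OF subspace_W] L_subset])
  then show ?thesis
    unfolding eventually_const_def eventually_sequentially by (metis order_refl)
qed

end
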